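(* Let $(M,\phi_\alpha,\xi_\alpha,\eta_\alpha,g)$, $\alpha\in\{1,2,3\}$, be a connected $3$-quasi-Sasakian manifold. Then there exists a constant $c\in\mathbb{R}$ such that, for every even permutation $(\alpha,\beta,\gamma)$ of $\{1,2,3\}$, $$[\xi_\alpha,\xi_\beta]=c\,\xi_\gamma .$$
   Context: All manifolds are smooth and connected. Convention: $2u\wedge v=u\otimes v-v\otimes u$, so for a $1$-form $\eta$, $2d\eta(X,Y)=X(\eta(Y))-Y(\eta(X))-\eta([X,Y])$. An almost contact structure on an odd-dimensional manifold $M$ is a triple $(\phi,\xi,\eta)$ of a $(1,1)$-tensor field, a vector field (the Reeb vector field) and a $1$-form with $\phi^2=-I+\eta\otimes\xi$ and $\eta(\xi)=1$ (hence $\phi\xi=0$, $\eta\circ\phi=0$). It is normal if $N^{(1)}:=[\phi,\phi]+2d\eta\otimes\xi=0$, where $[\phi,\phi](X,Y)=\phi^2[X,Y]+[\phi X,\phi Y]-\phi[\phi X,Y]-\phi[X,\phi Y]$. A Riemannian metric $g$ is compatible if $g(\phi X,\phi Y)=g(X,Y)-\eta(X)\eta(Y)$; the fundamental $2$-form is $\Phi(X,Y)=g(X,\phi Y)$. An almost $3$-contact metric manifold is a $(4n+3)$-dimensional manifold $M$ with three almost contact structures $(\phi_\alpha,\xi_\alpha,\eta_\alpha)$, $\alpha\in\{1,2,3\}$, and a Riemannian metric $g$ compatible with each of them, such that for every even permutation $(\alpha,\beta,\gamma)$ of $\{1,2,3\}$: $\phi_\gamma=\phi_\alpha\phi_\beta-\eta_\beta\otimes\xi_\alpha=-\phi_\beta\phi_\alpha+\eta_\alpha\otimes\xi_\beta$,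 $\xi_\gamma=\phi_\alpha\xi_\beta=-\phi_\beta\xi_\alpha$, $\eta_\gamma=\eta_\alpha\circ\phi_\beta=-\eta_\beta\circ\phi_\alpha$. It is hyper-normal if each of the three almost contact structures is normal. A $3$-quasi-Sasakian manifold is a hyper-normal almost $3$-contact metric manifold such that each fundamental $2$-form $\Phi_\alpha(X,Y)=g(X,\phi_\alpha Y)$ is closed. *)

theory Defs
  imports
    "HOL-Analysis.Analysis"
    "HOL-Library.Function_Algebras"
    "HOL-Combinatorics.Permutations"
begin

text \<open>
  Functions into a real vector space form a real vector space pointwise. Smooth functions,
  tangent vectors (derivations) and vector fields are all represented by functions, so
  \<open>+\<close>, \<open>-\<close>, \<open>*\<^sub>R\<close> and \<open>0\<close> below are pointwise operations.
\<close>

instantiation "fun" :: (type, real_vector) real_vector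
begin

definition scaleR_fun :: "real \<Rightarrow> ('a \<Rightarrow> 'b) \<Rightarrow> 'a \<Rightarrow> 'b"
  where "scaleR_fun c f = (\<lambda>x. c *\<^sub>R f x)"

instance
  by standard (simp_all add: scaleR_fun_def fun_eq_iff scaleR_add_right scaleR_add_left)

end

section \<open>Smooth manifolds\<close>

text \<open>Only meant for open \<open>S\<close>.\<close>

primrec Ck_on :: "nat \<Rightarrow> 'a::euclidean_space set \<Rightarrow> ('a \<Rightarrow> 'b::real_normed_vector) \<Rightarrow> bool"
  where
    "Ck_on 0 S f \<longleftrightarrow> continuous_on S f"
  | "Ck_on (Suc k) S f \<longleftrightarrow>
       (\<forall>x\<in>S. f differentiable (at x)) \<and>
       (\<forall>v. Ck_on k S (\<lambda>x. frechet_derivative f (at x) v))"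

definition smooth_on :: "'a::euclidean_space set \<Rightarrow> ('a \<Rightarrow> 'b::real_normed_vector) \<Rightarrow> bool"
  where "smooth_on S f \<longleftrightarrow> (\<forall>k. Ck_on k S f)"

text \<open>
  A chart is its domain together with the coordinate map; the values of the coordinate map
  outside the domain are irrelevant. The manifold is the whole type \<open>'m\<close>, its dimension is
  \<open>DIM('e)\<close>. The atlas need not be maximal: everything below depends only on the smooth
  structure that it generates.
\<close>

type_synonym ('m, 'e) chart = "'m set \<times> ('m \<Rightarrow> 'e)"

locale smooth_manifold =
  fixes \<A> :: "('m::{t2_space, second_countable_topology}, 'e::euclidean_space) chart set"
  assumes chart_open: "(U, \<kappa>) \<in> \<A> \<Longrightarrow> open U"
    and chart_image_open: "(U, \<kappa>) \<in> \<A> \<Longrightarrow> open (\<kappa> ` U)"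
    and chart_homeomorphism: "(U, \<kappa>) \<in> \<A> \<Longrightarrow> homeomorphism U (\<kappa> ` U) \<kappa> (inv_into U \<kappa>)"
    and charts_cover: "(\<Union>(U, \<kappa>)\<in>\<A>. U) = UNIV"
    and charts_compatible:
      "(U, \<kappa>) \<in> \<A> \<Longrightarrow> (V, \<mu>) \<in> \<A> \<Longrightarrow> smooth_on (\<kappa> ` (U \<inter> V)) (\<mu> \<circ> inv_into U \<kappa>)"

definition smooth_fun ::
    "('m::topological_space, 'e::euclidean_space) chart set \<Rightarrow> ('m \<Rightarrow> real) \<Rightarrow> bool"
  where "smooth_fun \<A> f \<longleftrightarrow> (\<forall>(U, \<kappa>)\<in>\<A>. smooth_on (\<kappa> ` U) (f \<circ> inv_into U \<kappa>))"

section \<open>Tangent vectors and tensor fields\<close>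

text \<open>
  A tangent vector at \<open>p\<close> is a derivation at \<open>p\<close> of the algebra of smooth functions. As HOL
  functions are total, it is normalised to \<open>0\<close> on non-smooth functions, so that equality of
  tangent vectors is equality of HOL functions.
\<close>

type_synonym 'm tvec = "('m \<Rightarrow> real) \<Rightarrow> real"
type_synonym 'm vfield = "'m \<Rightarrow> 'm tvec"

definition tangent_space ::
    "('m::topological_space, 'e::euclidean_space) chart set \<Rightarrow> 'm \<Rightarrow> 'm tvec set"
  where "tangent_space \<A> p = {v.
    (\<forall>f h. smooth_fun \<A> f \<and> smooth_fun \<A> h \<longrightarrow> v (f + h) = v f + v h) \<and>
    (\<forall>c f. smooth_fun \<A> f \<longrightarrow> v (c *\<^sub>R f) = c * v f) \<and>
    (\<forall>f h. smooth_fun \<A> f \<and> smooth_fun \<A> h \<longrightarrow> v (f * h) = f p * v h + h p * v f) \<and>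
    (\<forall>f. \<not> smooth_fun \<A> f \<longrightarrow> v f = 0)}"

definition vf_apply :: "'m vfield \<Rightarrow> ('m \<Rightarrow> real) \<Rightarrow> 'm \<Rightarrow> real"
  where "vf_apply X f = (\<lambda>p. X p f)"

definition vector_field ::
    "('m::topological_space, 'e::euclidean_space) chart set \<Rightarrow> 'm vfield \<Rightarrow> bool"
  where "vector_field \<A> X \<longleftrightarrow>
    (\<forall>p. X p \<in> tangent_space \<A> p) \<and>
    (\<forall>f. smooth_fun \<A> f \<longrightarrow> smooth_fun \<A> (vf_apply X f))"

text \<open>
  The tensor fields below are smooth families of (multi)linear maps on the tangent spaces,
  smoothness being tested on smooth vector fields. Their values at arguments outside the
  tangent space are irrelevant.
\<close>

definition linear_on_tangent ::
    "('m::topological_space, 'e::euclidean_space) chart set \<Rightarrow> 'm \<Rightarrow>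
      ('m tvec \<Rightarrow> 'b::real_vector) \<Rightarrow> bool"
  where "linear_on_tangent \<A> p L \<longleftrightarrow>
    (\<forall>v\<in>tangent_space \<A> p. \<forall>w\<in>tangent_space \<A> p. L (v + w) = L v + L w) \<and>
    (\<forall>c. \<forall>v\<in>tangent_space \<A> p. L (c *\<^sub>R v) = c *\<^sub>R L v)"

definition one_form ::
    "('m::topological_space, 'e::euclidean_space) chart set \<Rightarrow> ('m \<Rightarrow> 'm tvec \<Rightarrow> real) \<Rightarrow> bool"
  where "one_form \<A> \<eta> \<longleftrightarrow>
    (\<forall>p. linear_on_tangent \<A> p (\<eta> p)) \<and>
    (\<forall>X. vector_field \<A> X \<longrightarrow> smooth_fun \<A> (\<lambda>p. \<eta> p (X p)))"

definition endo_apply :: "('m \<Rightarrow> 'm tvec \<Rightarrow> 'm tvec) \<Rightarrow> 'm vfield \<Rightarrow> 'm vfield"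
  where "endo_apply \<phi> X = (\<lambda>p. \<phi> p (X p))"

definition endo_field ::
    "('m::topological_space, 'e::euclidean_space) chart set \<Rightarrow>
      ('m \<Rightarrow> 'm tvec \<Rightarrow> 'm tvec) \<Rightarrow> bool"
  where "endo_field \<A> \<phi> \<longleftrightarrow>
    (\<forall>p. linear_on_tangent \<A> p (\<phi> p) \<and> \<phi> p ` tangent_space \<A> p \<subseteq> tangent_space \<A> p) \<and>
    (\<forall>X. vector_field \<A> X \<longrightarrow> vector_field \<A> (endo_apply \<phi> X))"

definition riemannian_metric ::
    "('m::topological_space, 'e::euclidean_space) chart set \<Rightarrow>
      ('m \<Rightarrow> 'm tvec \<Rightarrow> 'm tvec \<Rightarrow> real) \<Rightarrow> bool"
  where "riemannian_metric \<A> g \<longleftrightarrow>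
    (\<forall>p. \<forall>v\<in>tangent_space \<A> p.
       linear_on_tangent \<A> p (g p v) \<and> linear_on_tangent \<A> p (\<lambda>w. g p w v)) \<and>
    (\<forall>p. \<forall>v\<in>tangent_space \<A> p. \<forall>w\<in>tangent_space \<A> p. g p v w = g p w v) \<and>
    (\<forall>p. \<forall>v\<in>tangent_space \<A> p. v \<noteq> 0 \<longrightarrow> 0 < g p v v) \<and>
    (\<forall>X Y. vector_field \<A> X \<and> vector_field \<A> Y \<longrightarrow> smooth_fun \<A> (\<lambda>p. g p (X p) (Y p)))"

definition lie_bracket :: "'m vfield \<Rightarrow> 'm vfield \<Rightarrow> 'm vfield"
  where "lie_bracket X Y = (\<lambda>p f. X p (vf_apply Y f) - Y p (vf_apply X f))"

text \<open>
  Exterior derivatives of 1-forms and 2-forms, evaluated on vector fields. The factors 1/2 and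
  1/3 come from the convention \<open>2 u \<and> v = u \<otimes> v - v \<otimes> u\<close>.
\<close>

definition ext_deriv1 ::
    "('m \<Rightarrow> 'm tvec \<Rightarrow> real) \<Rightarrow> 'm vfield \<Rightarrow> 'm vfield \<Rightarrow> 'm \<Rightarrow> real"
  where "ext_deriv1 \<eta> X Y p =
    (X p (\<lambda>q. \<eta> q (Y q)) - Y p (\<lambda>q. \<eta> q (X q)) - \<eta> p (lie_bracket X Y p)) / 2"

definition ext_deriv2 ::
    "('m \<Rightarrow> 'm tvec \<Rightarrow> 'm tvec \<Rightarrow> real) \<Rightarrow>
      'm vfield \<Rightarrow> 'm vfield \<Rightarrow> 'm vfield \<Rightarrow> 'm \<Rightarrow> real"
  where "ext_deriv2 \<omega> X Y Z p =
    (X p (\<lambda>q. \<omega> q (Y q) (Z q)) + Y p (\<lambda>q. \<omega> q (Z q) (X q)) + Z p (\<lambda>q. \<omega> q (X q) (Y q))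
     - \<omega> p (lie_bracket X Y p) (Z p) - \<omega> p (lie_bracket Y Z p) (X p)
     - \<omega> p (lie_bracket Z X p) (Y p)) / 3"

definition closed_2form ::
    "('m::topological_space, 'e::euclidean_space) chart set \<Rightarrow>
      ('m \<Rightarrow> 'm tvec \<Rightarrow> 'm tvec \<Rightarrow> real) \<Rightarrow> bool"
  where "closed_2form \<A> \<omega> \<longleftrightarrow>
    (\<forall>X Y Z. vector_field \<A> X \<and> vector_field \<A> Y \<and> vector_field \<A> Z \<longrightarrow>
       (\<forall>p. ext_deriv2 \<omega> X Y Z p = 0))"

section \<open>Almost contact structures\<close>

locale almost_contact_structure = smooth_manifold \<A>
  for \<A> :: "('m::{t2_space, second_countable_topology}, 'e::euclidean_space) chart set" +
  fixes \<phi> :: "'m \<Rightarrow> 'm tvec \<Rightarrow> 'm tvec"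
    and \<xi> :: "'m vfield"
    and \<eta> :: "'m \<Rightarrow> 'm tvec \<Rightarrow> real"
  assumes odd_dim: "odd DIM('e)"
    and phi_endo: "endo_field \<A> \<phi>"
    and xi_field: "vector_field \<A> \<xi>"
    and eta_form: "one_form \<A> \<eta>"
    and phi_sq: "v \<in> tangent_space \<A> p \<Longrightarrow> \<phi> p (\<phi> p v) = - v + \<eta> p v *\<^sub>R \<xi> p"
    and eta_xi: "\<eta> p (\<xi> p) = 1"

definition nijenhuis ::
    "('m \<Rightarrow> 'm tvec \<Rightarrow> 'm tvec) \<Rightarrow> 'm vfield \<Rightarrow> 'm vfield \<Rightarrow> 'm vfield"
  where "nijenhuis \<phi> X Y =
    endo_apply \<phi> (endo_apply \<phi> (lie_bracket X Y))
    + lie_bracket (endo_apply \<phi> X) (endo_apply \<phi> Y)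
    - endo_apply \<phi> (lie_bracket (endo_apply \<phi> X) Y)
    - endo_apply \<phi> (lie_bracket X (endo_apply \<phi> Y))"

definition normal_structure ::
    "('m::topological_space, 'e::euclidean_space) chart set \<Rightarrow>
      ('m \<Rightarrow> 'm tvec \<Rightarrow> 'm tvec) \<Rightarrow> 'm vfield \<Rightarrow> ('m \<Rightarrow> 'm tvec \<Rightarrow> real) \<Rightarrow> bool"
  where "normal_structure \<A> \<phi> \<xi> \<eta> \<longleftrightarrow>
    (\<forall>X Y. vector_field \<A> X \<and> vector_field \<A> Y \<longrightarrow>
       (\<forall>p. nijenhuis \<phi> X Y p + (2 * ext_deriv1 \<eta> X Y p) *\<^sub>R \<xi> p = 0))"

definition compatible_metric ::
    "('m::topological_space, 'e::euclidean_space) chart set \<Rightarrow>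
      ('m \<Rightarrow> 'm tvec \<Rightarrow> 'm tvec) \<Rightarrow> ('m \<Rightarrow> 'm tvec \<Rightarrow> real) \<Rightarrow>
      ('m \<Rightarrow> 'm tvec \<Rightarrow> 'm tvec \<Rightarrow> real) \<Rightarrow> bool"
  where "compatible_metric \<A> \<phi> \<eta> g \<longleftrightarrow>
    (\<forall>p. \<forall>v\<in>tangent_space \<A> p. \<forall>w\<in>tangent_space \<A> p.
       g p (\<phi> p v) (\<phi> p w) = g p v w - \<eta> p v * \<eta> p w)"

definition fundamental_form ::
    "('m \<Rightarrow> 'm tvec \<Rightarrow> 'm tvec) \<Rightarrow> ('m \<Rightarrow> 'm tvec \<Rightarrow> 'm tvec \<Rightarrow> real) \<Rightarrow>
      'm \<Rightarrow> 'm tvec \<Rightarrow> 'm tvec \<Rightarrow> real"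
  where "fundamental_form \<phi> g p v w = g p v (\<phi> p w)"

section \<open>3-quasi-Sasakian manifolds\<close>

definition even_perm3 :: "nat \<Rightarrow> nat \<Rightarrow> nat \<Rightarrow> bool"
  where "even_perm3 \<alpha> \<beta> \<gamma> \<longleftrightarrow>
    (\<exists>\<sigma>. \<sigma> permutes {1, 2, 3} \<and> evenperm \<sigma> \<and> \<alpha> = \<sigma> 1 \<and> \<beta> = \<sigma> 2 \<and> \<gamma> = \<sigma> 3)"

lemma even_perm3_iff:
  "even_perm3 \<alpha> \<beta> \<gamma> \<longleftrightarrow> (\<alpha>, \<beta>, \<gamma>) \<in> {(1, 2, 3), (2, 3, 1), (3, 1, 2)}"
proof
  assume "even_perm3 \<alpha> \<beta> \<gamma>"
  then obtain \<sigma> where \<sigma>: "\<sigma> permutes {1, 2, 3}" "evenperm \<sigma>"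
    and val: "\<alpha> = \<sigma> 1" "\<beta> = \<sigma> 2" "\<gamma> = \<sigma> 3"
    unfolding even_perm3_def by blast
  have mem: "\<sigma> 1 \<in> {1, 2, 3}" "\<sigma> 2 \<in> {1, 2, 3}" "\<sigma> 3 \<in> {1, 2, 3}"
    using permutes_in_image[OF \<sigma>(1)] by auto
  have dist: "\<sigma> 1 \<noteq> \<sigma> 2" "\<sigma> 1 \<noteq> \<sigma> 3" "\<sigma> 2 \<noteq> \<sigma> 3"
    using permutes_inj[OF \<sigma>(1)] by (simp_all add: inj_eq)
  have out: "x = 1 \<or> x = 2 \<or> x = 3 \<or> \<sigma> x = x" for x
    using permutes_not_in[OF \<sigma>(1), of x] by blast
  have "\<not> (\<sigma> 1 = 1 \<and> \<sigma> 2 = 3 \<and> \<sigma> 3 = 2)"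
  proof
    assume "\<sigma> 1 = 1 \<and> \<sigma> 2 = 3 \<and> \<sigma> 3 = 2"
    then have "\<sigma> x = Transposition.transpose 2 3 x" for x
      using out[of x] by (auto simp: Transposition.transpose_def)
    then have "\<sigma> = Transposition.transpose 2 3" by (rule ext)
    with \<sigma>(2) show False by (simp add: evenperm_swap)
  qed
  moreover have "\<not> (\<sigma> 1 = 2 \<and> \<sigma> 2 = 1 \<and> \<sigma> 3 = 3)"
  proof
    assume "\<sigma> 1 = 2 \<and> \<sigma> 2 = 1 \<and> \<sigma> 3 = 3"
    then have "\<sigma> x = Transposition.transpose 1 2 x" for x
      using out[of x] by (auto simp: Transposition.transpose_def)
    then have "\<sigma> = Transposition.transpose 1 2" by (rule ext)
    with \<sigma>(2) show False by (simp add: evenperm_swap)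
  qed
  moreover have "\<not> (\<sigma> 1 = 3 \<and> \<sigma> 2 = 2 \<and> \<sigma> 3 = 1)"
  proof
    assume "\<sigma> 1 = 3 \<and> \<sigma> 2 = 2 \<and> \<sigma> 3 = 1"
    then have "\<sigma> x = Transposition.transpose 1 3 x" for x
      using out[of x] by (auto simp: Transposition.transpose_def)
    then have "\<sigma> = Transposition.transpose 1 3" by (rule ext)
    with \<sigma>(2) show False by (simp add: evenperm_swap)
  qed
  ultimately show "(\<alpha>, \<beta>, \<gamma>) \<in> {(1, 2, 3), (2, 3, 1), (3, 1, 2)}"
    using mem dist unfolding val by - (elim insertE emptyE; simp)
next
  have cycle: "Transposition.transpose a b \<circ> Transposition.transpose b c permutes {1, 2, 3} \<and>
      evenperm (Transposition.transpose a b \<circ> Transposition.transpose b c)"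
    if "a \<in> {1, 2, 3}" "b \<in> {1, 2, 3}" "c \<in> {1, 2, 3}" "a \<noteq> b" "b \<noteq> c" for a b c :: nat
  proof
    show "Transposition.transpose a b \<circ> Transposition.transpose b c permutes {1, 2, 3}"
      using that by (intro permutes_compose permutes_swap_id) auto
    show "evenperm (Transposition.transpose a b \<circ> Transposition.transpose b c)"
      using that by (simp add: evenperm_comp permutation_swap_id evenperm_swap)
  qed
  assume "(\<alpha>, \<beta>, \<gamma>) \<in> {(1, 2, 3), (2, 3, 1), (3, 1, 2)}"
  then consider "\<alpha> = 1" "\<beta> = 2" "\<gamma> = 3" | "\<alpha> = 2" "\<beta> = 3" "\<gamma> = 1" | "\<alpha> = 3" "\<beta> = 1" "\<gamma> = 2"
    by auto
  then show "even_perm3 \<alpha> \<beta> \<gamma>"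
  proof cases
    case 1
    then show ?thesis
      unfolding even_perm3_def by (intro exI[of _ id]) (auto simp: permutes_id)
  next
    case 2
    then show ?thesis
      unfolding even_perm3_def using cycle[of 1 2 3]
      by (intro exI[of _ "Transposition.transpose 1 2 \<circ> Transposition.transpose 2 3"]) (auto simp: Transposition.transpose_def)
  next
    case 3
    then show ?thesis
      unfolding even_perm3_def using cycle[of 1 3 2]
      by (intro exI[of _ "Transposition.transpose 1 3 \<circ> Transposition.transpose 3 2"]) (auto simp: Transposition.transpose_def)
  qed
qed

text \<open>The three structures are indexed by \<open>{1, 2, 3} :: nat set\<close>; other indices are irrelevant.\<close>

locale almost_3_contact_metric = smooth_manifold \<A>
  for \<A> :: "('m::{t2_space, second_countable_topology}, 'e::euclidean_space) chart set" +
  fixes \<phi> :: "nat \<Rightarrow> 'm \<Rightarrow> 'm tvec \<Rightarrow> 'm tvec"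
    and \<xi> :: "nat \<Rightarrow> 'm vfield"
    and \<eta> :: "nat \<Rightarrow> 'm \<Rightarrow> 'm tvec \<Rightarrow> real"
    and g :: "'m \<Rightarrow> 'm tvec \<Rightarrow> 'm tvec \<Rightarrow> real"
  assumes dim: "\<exists>n::nat. DIM('e) = 4 * n + 3"
    and almost_contact:
      "\<alpha> \<in> {1, 2, 3} \<Longrightarrow> almost_contact_structure \<A> (\<phi> \<alpha>) (\<xi> \<alpha>) (\<eta> \<alpha>)"
    and metric: "riemannian_metric \<A> g"
    and metric_compatible: "\<alpha> \<in> {1, 2, 3} \<Longrightarrow> compatible_metric \<A> (\<phi> \<alpha>) (\<eta> \<alpha>) g"
    and phi_phi:
      "even_perm3 \<alpha> \<beta> \<gamma> \<Longrightarrow> v \<in> tangent_space \<A> p \<Longrightarrow>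
         \<phi> \<gamma> p v = \<phi> \<alpha> p (\<phi> \<beta> p v) - \<eta> \<beta> p v *\<^sub>R \<xi> \<alpha> p"
      "even_perm3 \<alpha> \<beta> \<gamma> \<Longrightarrow> v \<in> tangent_space \<A> p \<Longrightarrow>
         \<phi> \<gamma> p v = - \<phi> \<beta> p (\<phi> \<alpha> p v) + \<eta> \<alpha> p v *\<^sub>R \<xi> \<beta> p"
    and phi_xi:
      "even_perm3 \<alpha> \<beta> \<gamma> \<Longrightarrow> \<xi> \<gamma> p = \<phi> \<alpha> p (\<xi> \<beta> p)"
      "even_perm3 \<alpha> \<beta> \<gamma> \<Longrightarrow> \<xi> \<gamma> p = - \<phi> \<beta> p (\<xi> \<alpha> p)"
    and eta_phi:
      "even_perm3 \<alpha> \<beta> \<gamma> \<Longrightarrow> v \<in> tangent_space \<A> p \<Longrightarrow> \<eta> \<gamma> p v = \<eta> \<alpha> p (\<phi> \<beta> p v)"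
      "even_perm3 \<alpha> \<beta> \<gamma> \<Longrightarrow> v \<in> tangent_space \<A> p \<Longrightarrow> \<eta> \<gamma> p v = - \<eta> \<beta> p (\<phi> \<alpha> p v)"

locale three_quasi_sasakian = almost_3_contact_metric \<A> \<phi> \<xi> \<eta> g
  for \<A> :: "('m::{t2_space, second_countable_topology}, 'e::euclidean_space) chart set"
    and \<phi> \<xi> \<eta> g +
  assumes hyper_normal: "\<alpha> \<in> {1, 2, 3} \<Longrightarrow> normal_structure \<A> (\<phi> \<alpha>) (\<xi> \<alpha>) (\<eta> \<alpha>)"
    and fundamental_closed: "\<alpha> \<in> {1, 2, 3} \<Longrightarrow> closed_2form \<A> (fundamental_form (\<phi> \<alpha>) g)"

end

theory Submission
  imports Defs "HOL-Real_Asymp.Real_Asymp"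
begin

text \<open>
  Normality in the direction of the Reeb field gives \<open>L\<^bsub>\<xi>\<^esub> \<eta> = 0\<close> and \<open>L\<^bsub>\<xi>\<^esub> \<phi> = 0\<close>, and together with
  \<open>d\<Phi> = 0\<close> it makes every \<open>\<xi>\<^sub>\<alpha>\<close> a Killing field. Since \<open>\<Phi>\<^sub>\<alpha>(\<xi>\<^sub>\<beta>, X)\<close> and \<open>\<Phi>\<^sub>\<alpha>(\<xi>\<^sub>\<gamma>, X)\<close> are \<open>-\<eta>\<^sub>\<gamma>(X)\<close>
  and \<open>\<eta>\<^sub>\<beta>(X)\<close>, the identity \<open>d\<Phi>\<^sub>\<alpha>(\<xi>\<^sub>\<beta>, \<xi>\<^sub>\<gamma>, X) = 0\<close> reduces by \<open>L\<^bsub>\<xi>\<^esub> \<eta> = 0\<close> to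
  \<open>\<Phi>\<^sub>\<alpha>([\<xi>\<^sub>\<beta>, \<xi>\<^sub>\<gamma>], X) = 0\<close>, so that \<open>[\<xi>\<^sub>\<beta>, \<xi>\<^sub>\<gamma>]\<close> is a multiple of \<open>\<xi>\<^sub>\<alpha>\<close>. By \<open>L\<^bsub>\<xi>\<^esub> \<phi> = 0\<close> the
  three coefficients are the same function \<open>f\<close>. Finally \<open>f \<xi>\<^sub>\<gamma> = [\<xi>\<^sub>\<alpha>, \<xi>\<^sub>\<beta>]\<close> is again Killing, and a
  multiple of a unit Killing field is Killing only if \<open>df = 0\<close>. The hypotheses only speak about
  global vector fields; bump functions provide enough of them to conclude that \<open>f\<close> is constant.
\<close>

section \<open>Calculus of smooth functions\<close>

lemma Ck_on_imp_continuous_on: "Ck_on k S f \<Longrightarrow> continuous_on S f"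
  by (cases k) (auto intro!: continuous_at_imp_continuous_on differentiable_imp_continuous_within)

lemma Ck_on_SucD: "Ck_on (Suc k) S f \<Longrightarrow> Ck_on k S f"
proof (induction k arbitrary: f)
  case 0
  then show ?case using Ck_on_imp_continuous_on[OF 0] by simp
next
  case (Suc k)
  from Suc.prems have d: "\<forall>x\<in>S. f differentiable (at x)"
    and D: "Ck_on (Suc k) S (\<lambda>x. frechet_derivative f (at x) v)" for v
    unfolding Ck_on.simps(2)[of "Suc k"] by auto
  show ?case unfolding Ck_on.simps(2)[of k] using d Suc.IH[OF D] by auto
qed

text \<open>The derivative \<open>at x\<close> sees only values near \<open>x\<close>; since
  \<open>S\<close> is open, agreement on \<open>S\<close> is agreement near each of its
  points.\<close>

lemma Ck_on_cong:
  assumes "open S" and "\<And>x. x \<in> S \<Longrightarrow> f x = g x" and "Ck_on k S f"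
  shows "Ck_on k S g"
  using assms(2,3)
proof (induction k arbitrary: f g)
  case 0
  then show ?case by (metis Ck_on.simps(1) continuous_on_cong)
next
  case (Suc k)
  have g: "(g has_derivative frechet_derivative f (at x)) (at x)" if "x \<in> S" for x
  proof (rule has_derivative_transform_within_open[OF _ assms(1) that])
    show "(f has_derivative frechet_derivative f (at x)) (at x)"
      using Suc.prems(2) that by (simp add: frechet_derivative_works[symmetric])
  qed (simp add: Suc.prems(1))
  have "Ck_on k S (\<lambda>x. frechet_derivative g (at x) v)" for v
    by (rule Suc.IH[of "\<lambda>x. frechet_derivative f (at x) v"])
      (use Suc.prems(2) in \<open>auto simp: frechet_derivative_at[OF g]\<close>)
  with g show ?case by (auto simp: differentiable_def)
qed

text \<open>Lets the inductions below exhibit an explicit derivative \<open>D\<close> and treat that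
  expression; uniqueness of derivatives identifies it with
  \<open>frechet_derivative\<close>.\<close>

lemma Ck_on_has_derivativeI:
  assumes "open S" and D: "\<And>x. x \<in> S \<Longrightarrow> (f has_derivative D x) (at x)"
    and "\<And>v. Ck_on k S (\<lambda>x. D x v)"
  shows "Ck_on (Suc k) S f"
proof -
  have "Ck_on k S (\<lambda>x. frechet_derivative f (at x) v)" for v
    using frechet_derivative_at[OF D] by (intro Ck_on_cong[OF assms(1) _ assms(3)[of v]]) auto
  with D show ?thesis by (auto simp: differentiable_def)
qed

lemma Ck_on_has_derivative:
  "\<lbrakk>Ck_on (Suc k) S f; x \<in> S\<rbrakk> \<Longrightarrow> (f has_derivative frechet_derivative f (at x)) (at x)"
  by (simp add: frechet_derivative_works[symmetric])

lemma Ck_on_subset: "\<lbrakk>Ck_on k S f; T \<subseteq> S\<rbrakk> \<Longrightarrow> Ck_on k T f"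
  by (induction k arbitrary: f) (auto intro: continuous_on_subset)

text \<open>Derivatives are taken in the full space, so \<open>Ck_on\<close> is a local condition.
  This permits different formulas near different points, as in
  \<open>chart_field_smooth\<close>.\<close>

lemma Ck_on_cover:
  assumes "\<And>x. x \<in> S \<Longrightarrow> \<exists>T. open T \<and> x \<in> T \<and> Ck_on k T f"
  shows "Ck_on k S f"
  using assms
proof (induction k arbitrary: f)
  case 0
  then have "isCont f x" if "x \<in> S" for x
    using that by (metis Ck_on.simps(1) continuous_on_eq_continuous_at)
  then show ?case by (simp add: continuous_at_imp_continuous_on)
next
  case (Suc k)
  show ?case unfolding Ck_on.simps(2)[of k]
  proof (intro conjI ballI allI)
    show "f differentiable (at x)" if "x \<in> S" for x
      using Suc.prems[OF that] by auto
    show "Ck_on k S (\<lambda>x. frechet_derivative f (at x) v)" for v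
      using Suc.prems by (intro Suc.IH) fastforce
  qed
qed

lemma Ck_on_const: "Ck_on k S (\<lambda>x. c)"
  by (induction k arbitrary: c) (auto simp: frechet_derivative_const)

lemma Ck_on_bounded_linear:
  assumes "bounded_linear L" and "open S" and "Ck_on k S f"
  shows "Ck_on k S (\<lambda>x. L (f x))"
  using assms(3)
proof (induction k arbitrary: f)
  case 0
  then show ?case
    using assms(1) by (auto intro: bounded_linear.continuous_on)
next
  case (Suc k)
  then show ?case
    by (intro Ck_on_has_derivativeI[where D = "\<lambda>x v. L (frechet_derivative f (at x) v)"]
        bounded_linear.has_derivative[OF assms(1)] assms(2) Ck_on_has_derivative[OF Suc.prems]) auto
qed

lemma Ck_on_add:
  assumes "open S" and "Ck_on k S f" and "Ck_on k S g"
  shows "Ck_on k S (\<lambda>x. f x + g x)"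
  using assms(2,3)
proof (induction k arbitrary: f g)
  case 0
  then show ?case by (auto intro: continuous_intros)
next
  case (Suc k)
  show ?case
    by (intro Ck_on_has_derivativeI[where D = "\<lambda>x v. frechet_derivative f (at x) v + frechet_derivative g (at x) v"]
        assms has_derivative_add Ck_on_has_derivative[OF Suc.prems(1)]
        Ck_on_has_derivative[OF Suc.prems(2)] Suc.IH) (use Suc.prems in auto)
qed

lemma Ck_on_sum:
  assumes "open S" and "finite I" and "\<And>i. i \<in> I \<Longrightarrow> Ck_on k S (f i)"
  shows "Ck_on k S (\<lambda>x. \<Sum>i\<in>I. f i x)"
  using assms(2,3) by (induction I) (auto intro: Ck_on_const Ck_on_add assms(1))

text \<open>The Leibniz rule, for any bounded bilinear map so that it serves products, scalar
  multiples and inner products alike.\<close>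

lemma Ck_on_bilinear:
  assumes "bounded_bilinear B" and "open S" and "Ck_on k S f" and "Ck_on k S g"
  shows "Ck_on k S (\<lambda>x. B (f x) (g x))"
  using assms(3,4)
proof (induction k arbitrary: f g)
  case 0
  then show ?case using bounded_bilinear.continuous_on[OF assms(1)] by auto
next
  case (Suc k)
  show ?case
    by (intro Ck_on_has_derivativeI[where D = "\<lambda>x v. B (f x) (frechet_derivative g (at x) v)
          + B (frechet_derivative f (at x) v) (g x)"]
        assms bounded_bilinear.FDERIV[OF assms(1)] Ck_on_has_derivative[OF Suc.prems(1)]
        Ck_on_has_derivative[OF Suc.prems(2)] Ck_on_add Suc.IH Ck_on_SucD[OF Suc.prems(1)]
        Ck_on_SucD[OF Suc.prems(2)]) (use Suc.prems in auto)
qed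

text \<open>The chain rule evaluates the derivative of \<open>f\<close> in a direction that varies
  with \<open>x\<close>, while \<open>Ck_on\<close> controls fixed directions only. Expanding the
  direction in \<open>Basis\<close> leaves fixed directional derivatives of \<open>f\<close>, to
  which the induction hypothesis applies, with smooth coefficients.\<close>

lemma Ck_on_compose:
  fixes g :: "'a::euclidean_space \<Rightarrow> 'b::euclidean_space"
  assumes "open S" and "open T" and "g ` S \<subseteq> T" and "Ck_on k T f" and "Ck_on k S g"
  shows "Ck_on k S (\<lambda>x. f (g x))"
  using assms(4,5)
proof (induction k arbitrary: f)
  case 0
  then show ?case using assms(3) by (auto intro: continuous_on_compose2)
next
  case (Suc k)
  have f: "(f has_derivative frechet_derivative f (at (g x))) (at (g x))" if "x \<in> S" for x
    using Ck_on_has_derivative[OF Suc.prems(1)] assms(3) that by blast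
  have expand: "frechet_derivative f (at (g x)) w
      = (\<Sum>b\<in>Basis. (w \<bullet> b) *\<^sub>R frechet_derivative f (at (g x)) b)" if "x \<in> S" for x w
  proof -
    have lin: "linear (frechet_derivative f (at (g x)))"
      using f[OF that] has_derivative_linear by blast
    show ?thesis
      by (subst euclidean_representation[of w, symmetric])
        (simp only: linear_sum[OF lin] linear_scale[OF lin])
  qed
  show ?case
  proof (rule Ck_on_has_derivativeI[OF assms(1)])
    fix x assume "x \<in> S"
    show "((\<lambda>x. f (g x)) has_derivative
        (\<lambda>v. frechet_derivative f (at (g x)) (frechet_derivative g (at x) v))) (at x)"
      using has_derivative_compose[OF Ck_on_has_derivative[OF Suc.prems(2) \<open>x \<in> S\<close>] f[OF \<open>x \<in> S\<close>]] .
  next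
    fix v
    have "Ck_on k S (\<lambda>x. \<Sum>b\<in>Basis. (frechet_derivative g (at x) v \<bullet> b) *\<^sub>R
        frechet_derivative f (at (g x)) b)"
      by (intro Ck_on_sum assms(1) finite_Basis Ck_on_bilinear[OF bounded_bilinear_scaleR]
          Ck_on_bounded_linear[OF bounded_linear_inner_left] Suc.IH Ck_on_SucD[OF Suc.prems(2)])
        (use Suc.prems in auto)
    then show "Ck_on k S (\<lambda>x. frechet_derivative f (at (g x)) (frechet_derivative g (at x) v))"
      by (rule Ck_on_cong[OF assms(1), rotated]) (use expand in force)
  qed
qed

lemma Ck_on_ident: "Ck_on k S (\<lambda>x. x)"
  by (cases k) (auto simp: Ck_on_const)

section \<open>Smooth bump functions on Euclidean space\<close>

definition flat_exp :: "nat \<Rightarrow> real \<Rightarrow> real"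
  where "flat_exp n t = (if t > 0 then exp (- 1 / t) / t ^ n else 0)"

lemma flat_exp_has_derivative:
  "(flat_exp n has_real_derivative flat_exp (n + 2) t - n * flat_exp (n + 1) t) (at t)"
proof -
  consider "t > 0" | "t < 0" | "t = 0" by linarith
  then show ?thesis
  proof cases
    case 1
    have "((\<lambda>t. exp (- 1 / t) * inverse (t ^ n)) has_real_derivative
        flat_exp (n + 2) t - n * flat_exp (n + 1) t) (at t)"
      using 1 by (auto intro!: derivative_eq_intros simp: flat_exp_def field_simps power2_eq_square; cases n; simp add: field_simps)
    then show ?thesis
      by (rule has_field_derivative_transform_within_open[where S = "{0<..}"])
        (use 1 in \<open>auto simp: flat_exp_def field_simps\<close>)
  next
    case 2
    have "((\<lambda>t. 0) has_real_derivative flat_exp (n + 2) t - n * flat_exp (n + 1) t) (at t)"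
      using 2 by (simp add: flat_exp_def)
    then show ?thesis
      by (rule has_field_derivative_transform_within_open[where S = "{..<0}"])
        (use 2 in \<open>auto simp: flat_exp_def\<close>)
  next
    case 3
    \<comment> \<open>At 0 the difference quotient is treated from each side; on the right
      \<open>exp (- 1 / h)\<close> decays faster than any power of \<open>h\<close>.\<close>
    have "((\<lambda>h. exp (- 1 / h) / h ^ n / h) \<longlongrightarrow> 0) (at_right (0::real))"
      by real_asymp
    then have "((\<lambda>h. flat_exp n h / h) \<longlongrightarrow> 0) (at_right 0)"
      by (rule Lim_transform_eventually)
        (auto simp: eventually_at_filter flat_exp_def)
    moreover have "((\<lambda>h. flat_exp n h / h) \<longlongrightarrow> 0) (at_left 0)"
      by (rule Lim_transform_eventually[of "\<lambda>_. 0"])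
        (auto simp: eventually_at_filter flat_exp_def)
    ultimately show ?thesis
      using 3 by (simp add: DERIV_def filterlim_split_at flat_exp_def)
  qed
qed

text \<open>The derivative is a linear combination of members of the same family. This is why
  \<open>flat_exp\<close> carries the power \<open>t ^ n\<close>, although the bump uses only
  \<open>n = 0\<close>.\<close>

lemma Ck_on_flat_exp: "Ck_on k S (flat_exp n)"
proof -
  have "Ck_on k UNIV (flat_exp n)"
  proof (induction k arbitrary: n)
    case 0
    then show ?case
      by (auto intro: DERIV_isCont continuous_at_imp_continuous_on flat_exp_has_derivative)
  next
    case (Suc k)
    show ?case
    proof (rule Ck_on_has_derivativeI[OF open_UNIV])
      show "(flat_exp n has_derivative
          (\<lambda>v. (flat_exp (n + 2) t + (- n) * flat_exp (n + 1) t) * v)) (at t)" for t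
        using flat_exp_has_derivative[of n t] by (simp add: has_field_derivative_def)
      show "Ck_on k UNIV (\<lambda>t. (flat_exp (n + 2) t + (- n) * flat_exp (n + 1) t) * v)" for v
        by (intro Ck_on_bilinear[OF bounded_bilinear_mult] Ck_on_add Suc.IH Ck_on_const open_UNIV)
    qed
  qed
  then show ?thesis by (rule Ck_on_subset) simp
qed

text \<open>The squared distance is smooth at the centre too, unlike the norm.\<close>

definition bump :: "'a::euclidean_space \<Rightarrow> real \<Rightarrow> 'a \<Rightarrow> real"
  where "bump a r x = flat_exp 0 (r\<^sup>2 + (-1) * ((x - a) \<bullet> (x - a)))"

lemma Ck_on_bump: "Ck_on k S (bump a r)"
proof -
  have "Ck_on k UNIV (\<lambda>x. x + - a)"
    by (intro Ck_on_add Ck_on_ident Ck_on_const open_UNIV)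
  then have "Ck_on k UNIV (bump a r)"
    unfolding bump_def
    by (intro Ck_on_compose[OF open_UNIV open_UNIV _ Ck_on_flat_exp] Ck_on_add Ck_on_const
        Ck_on_bilinear[OF bounded_bilinear_mult] Ck_on_bilinear[OF bounded_bilinear_inner] open_UNIV)
      auto
  then show ?thesis by (rule Ck_on_subset) simp
qed

lemma bump_center: "r > 0 \<Longrightarrow> bump a r a \<noteq> 0"
  by (simp add: bump_def flat_exp_def)

lemma bump_outside:
  assumes "r > 0" and "x \<notin> cball a r"
  shows "bump a r x = 0"
proof -
  have "r\<^sup>2 \<le> (norm (x - a))\<^sup>2"
    using assms by (intro power_mono) (auto simp: dist_norm norm_minus_commute)
  then show ?thesis by (simp add: bump_def flat_exp_def dot_square_norm)
qed

section \<open>Vector fields on a manifold\<close>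

lemma lie_bracket_swap: "lie_bracket Y X p = - lie_bracket X Y p"
  by (simp add: lie_bracket_def fun_eq_iff)

context smooth_manifold
begin

lemma smooth_fun_iff:
  "smooth_fun \<A> f \<longleftrightarrow>
    (\<forall>U \<kappa> k. (U, \<kappa>) \<in> \<A> \<longrightarrow> Ck_on k (\<kappa> ` U) (f \<circ> inv_into U \<kappa>))"
  unfolding smooth_fun_def smooth_on_def by blast

lemma smooth_const: "smooth_fun \<A> (\<lambda>p. c)"
  by (simp add: smooth_fun_iff comp_def Ck_on_const)

lemma smooth_mult:
  "\<lbrakk>smooth_fun \<A> f; smooth_fun \<A> h\<rbrakk> \<Longrightarrow> smooth_fun \<A> (\<lambda>p. f p * h p)"
  unfolding smooth_fun_iff comp_def
  by (intro allI impI Ck_on_bilinear[OF bounded_bilinear_mult] chart_image_open) auto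

lemma smooth_add:
  "\<lbrakk>smooth_fun \<A> f; smooth_fun \<A> h\<rbrakk> \<Longrightarrow> smooth_fun \<A> (\<lambda>p. f p + h p)"
  unfolding smooth_fun_iff comp_def by (intro allI impI Ck_on_add chart_image_open) auto

lemma smooth_diff:
  "\<lbrakk>smooth_fun \<A> f; smooth_fun \<A> h\<rbrakk> \<Longrightarrow> smooth_fun \<A> (\<lambda>p. f p - h p)"
  using smooth_add[of f, OF _ smooth_mult[OF smooth_const[of "-1"]]] by simp

section \<open>Tangent vectors as derivations\<close>

lemma tangent_nonsmooth: "\<lbrakk>v \<in> tangent_space \<A> p; \<not> smooth_fun \<A> f\<rbrakk> \<Longrightarrow> v f = 0"
  by (simp add: tangent_space_def)

lemma tangent_add:
  "\<lbrakk>v \<in> tangent_space \<A> p; smooth_fun \<A> f; smooth_fun \<A> h\<rbrakk>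
    \<Longrightarrow> v (\<lambda>q. f q + h q) = v f + v h"
  by (simp add: tangent_space_def plus_fun_def)

lemma tangent_mult:
  "\<lbrakk>v \<in> tangent_space \<A> p; smooth_fun \<A> f; smooth_fun \<A> h\<rbrakk>
    \<Longrightarrow> v (\<lambda>q. f q * h q) = f p * v h + h p * v f"
  by (simp add: tangent_space_def times_fun_def)

text \<open>The product rule for \<open>1 * 1\<close> makes the value at \<open>1\<close> twice
  itself, hence 0; homogeneity does the rest.\<close>

lemma tangent_const:
  assumes "v \<in> tangent_space \<A> p"
  shows "v (\<lambda>q. c) = 0"
proof -
  have "v (\<lambda>q. 1) = 0"
    using tangent_mult[OF assms smooth_const[of 1] smooth_const[of 1]] by simp
  moreover have "v (c *\<^sub>R (\<lambda>q. 1)) = c * v (\<lambda>q. 1)"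
    using assms smooth_const[of 1] by (simp add: tangent_space_def)
  ultimately show ?thesis by (simp add: scaleR_fun_def)
qed

lemma tangent_diff:
  assumes "v \<in> tangent_space \<A> p" and "smooth_fun \<A> f" and "smooth_fun \<A> h"
  shows "v (\<lambda>q. f q - h q) = v f - v h"
  using tangent_add[OF assms(1) smooth_diff[OF assms(2,3)] assms(3)] by simp

lemma tangent_spaceI:
  assumes "\<And>f h. \<lbrakk>smooth_fun \<A> f; smooth_fun \<A> h\<rbrakk> \<Longrightarrow> v (\<lambda>q. f q + h q) = v f + v h"
    and "\<And>f h. \<lbrakk>smooth_fun \<A> f; smooth_fun \<A> h\<rbrakk>
      \<Longrightarrow> v (\<lambda>q. f q * h q) = f p * v h + h p * v f"
    and "\<And>c f. smooth_fun \<A> f \<Longrightarrow> v (\<lambda>q. c * f q) = c * v f"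
    and "\<And>f. \<not> smooth_fun \<A> f \<Longrightarrow> v f = 0"
  shows "v \<in> tangent_space \<A> p"
  using assms by (simp add: tangent_space_def plus_fun_def times_fun_def scaleR_fun_def)

lemma tangent_scale:
  assumes "v \<in> tangent_space \<A> p" and "smooth_fun \<A> f"
  shows "v (\<lambda>q. c * f q) = c * v f"
  using tangent_mult[OF assms(1) smooth_const assms(2)] by (simp add: tangent_const[OF assms(1)])

lemma tangent_space_zero: "0 \<in> tangent_space \<A> p"
  by (rule tangent_spaceI) simp_all

lemma tangent_space_add:
  "\<lbrakk>v \<in> tangent_space \<A> p; w \<in> tangent_space \<A> p\<rbrakk> \<Longrightarrow> v + w \<in> tangent_space \<A> p"
  by (rule tangent_spaceI)
    (simp_all add: tangent_add tangent_mult tangent_scale tangent_nonsmooth algebra_simps)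

lemma tangent_space_scaleR:
  "v \<in> tangent_space \<A> p \<Longrightarrow> c *\<^sub>R v \<in> tangent_space \<A> p"
  by (rule tangent_spaceI)
    (simp_all add: scaleR_fun_def tangent_add tangent_mult tangent_scale tangent_nonsmooth algebra_simps)

lemma tangent_space_uminus: "v \<in> tangent_space \<A> p \<Longrightarrow> - v \<in> tangent_space \<A> p"
  using tangent_space_scaleR[of v p "-1"] by simp

lemma tangent_space_diff:
  "\<lbrakk>v \<in> tangent_space \<A> p; w \<in> tangent_space \<A> p\<rbrakk> \<Longrightarrow> v - w \<in> tangent_space \<A> p"
  using tangent_space_add[OF _ tangent_space_uminus, of v p w] by simp

section \<open>Vector fields and their brackets\<close>

lemma vector_field_tangent: "vector_field \<A> X \<Longrightarrow> X p \<in> tangent_space \<A> p"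
  by (simp add: vector_field_def)

lemma vector_field_smooth:
  "\<lbrakk>vector_field \<A> X; smooth_fun \<A> f\<rbrakk> \<Longrightarrow> smooth_fun \<A> (\<lambda>p. X p f)"
  by (simp add: vector_field_def vf_apply_def)

lemma vector_field_scale:
  assumes "smooth_fun \<A> f" and "vector_field \<A> X"
  shows "vector_field \<A> (\<lambda>p. f p *\<^sub>R X p)"
  using assms tangent_space_scaleR vector_field_tangent[OF assms(2)] vector_field_smooth[OF assms(2)]
  by (simp add: vector_field_def vf_apply_def) (simp add: scaleR_fun_def smooth_mult)

lemma lie_bracket_field:
  assumes X: "vector_field \<A> X" and Y: "vector_field \<A> Y"
  shows "vector_field \<A> (lie_bracket X Y)"
proof -
  note t = vector_field_tangent[OF X] vector_field_tangent[OF Y]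
  note s = vector_field_smooth[OF X] vector_field_smooth[OF Y]
  note eqs = t[THEN tangent_add] t[THEN tangent_mult] t[THEN tangent_scale]
    t[THEN tangent_nonsmooth] t[THEN tangent_const]
  have "lie_bracket X Y p \<in> tangent_space \<A> p" for p
    by (rule tangent_spaceI)
      (simp_all add: lie_bracket_def vf_apply_def eqs s smooth_mult smooth_add smooth_const algebra_simps)
  then show ?thesis
    by (auto simp: vector_field_def lie_bracket_def vf_apply_def intro!: smooth_diff s)
qed

text \<open>Both vectors are normalised to 0 on functions that are not smooth.\<close>

lemma tangent_eqI:
  assumes "v \<in> tangent_space \<A> p" and "w \<in> tangent_space \<A> p"
    and "\<And>f. smooth_fun \<A> f \<Longrightarrow> v f = w f"
  shows "v = w"
  using assms tangent_nonsmooth by (metis ext)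

text \<open>Brackets are commutators of operators on functions. In this form the Jacobi identity
  reads \<open>L_[X,Y] = L_X L_Y - L_Y L_X\<close>, as needed for brackets of Killing
  fields.\<close>

lemma lie_bracket_jacobi:
  assumes X: "vector_field \<A> X" and Y: "vector_field \<A> Y" and Z: "vector_field \<A> Z"
  shows "lie_bracket (lie_bracket X Y) Z p
    = lie_bracket X (lie_bracket Y Z) p - lie_bracket Y (lie_bracket X Z) p"
proof (rule tangent_eqI[of _ p])
  show "lie_bracket (lie_bracket X Y) Z p \<in> tangent_space \<A> p"
    by (intro vector_field_tangent lie_bracket_field assms)
  show "lie_bracket X (lie_bracket Y Z) p - lie_bracket Y (lie_bracket X Z) p
      \<in> tangent_space \<A> p"
    by (intro tangent_space_diff vector_field_tangent lie_bracket_field assms)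
  note t = assms[THEN vector_field_tangent]
  fix f assume f: "smooth_fun \<A> f"
  show "lie_bracket (lie_bracket X Y) Z p f
      = (lie_bracket X (lie_bracket Y Z) p - lie_bracket Y (lie_bracket X Z) p) f"
    using f by (simp add: lie_bracket_def vf_apply_def t[THEN tangent_diff] assms[THEN vector_field_smooth])
qed

lemma lie_bracket_scale:
  assumes f: "smooth_fun \<A> f" and X: "vector_field \<A> X" and Y: "vector_field \<A> Y"
  shows "lie_bracket (\<lambda>p. f p *\<^sub>R X p) Y p = f p *\<^sub>R lie_bracket X Y p - Y p f *\<^sub>R X p"
proof (rule tangent_eqI[of _ p])
  show "lie_bracket (\<lambda>p. f p *\<^sub>R X p) Y p \<in> tangent_space \<A> p"
    by (intro vector_field_tangent lie_bracket_field vector_field_scale assms)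
  show "f p *\<^sub>R lie_bracket X Y p - Y p f *\<^sub>R X p \<in> tangent_space \<A> p"
    by (intro tangent_space_diff tangent_space_scaleR vector_field_tangent lie_bracket_field assms)
  note t = assms(2,3)[THEN vector_field_tangent]
  fix h assume h: "smooth_fun \<A> h"
  show "lie_bracket (\<lambda>p. f p *\<^sub>R X p) Y p h = (f p *\<^sub>R lie_bracket X Y p - Y p f *\<^sub>R X p) h"
    using f h by (simp add: lie_bracket_def vf_apply_def scaleR_fun_def t[THEN tangent_mult]
        assms(2,3)[THEN vector_field_smooth] algebra_simps)
qed

section \<open>Cut-off coordinate fields and local constancy\<close>

lemma chart_inverse:
  assumes "(U, \<kappa>) \<in> \<A>" and "q \<in> U"
  shows "inv_into U \<kappa> (\<kappa> q) = q"
  using chart_homeomorphism[OF assms(1)] assms(2) by (simp add: homeomorphism_def)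

lemma chart_image_open_subset:
  assumes "(U, \<kappa>) \<in> \<A>" and "open W" and "W \<subseteq> U"
  shows "open (\<kappa> ` W)"
  using homeomorphism_imp_open_map[OF chart_homeomorphism[OF assms(1)], of W]
    assms chart_open[OF assms(1)] chart_image_open[OF assms(1)]
  by (simp add: openin_open_eq)

lemma chart_has_derivative:
  assumes "(U, \<kappa>) \<in> \<A>" and "smooth_fun \<A> f" and "q \<in> U"
  shows "((f \<circ> inv_into U \<kappa>) has_derivative
    frechet_derivative (f \<circ> inv_into U \<kappa>) (at (\<kappa> q))) (at (\<kappa> q))"
  using Ck_on_has_derivative[of 0 "\<kappa> ` U"] assms unfolding smooth_fun_iff by blast

text \<open>The coordinate field in direction \<open>w\<close>, cut off by a bump so that it can
  extend by 0 to the whole manifold. The test \<open>smooth_fun \<A> f\<close> is the normalisation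
  required by \<open>tangent_space\<close>.\<close>

definition chart_field ::
    "'m set \<Rightarrow> ('m \<Rightarrow> 'e) \<Rightarrow> 'e \<Rightarrow> real \<Rightarrow> 'e \<Rightarrow> 'm vfield"
  where "chart_field U \<kappa> a r w = (\<lambda>q f. if q \<in> U \<and> smooth_fun \<A> f
    then bump a r (\<kappa> q) * frechet_derivative (f \<circ> inv_into U \<kappa>) (at (\<kappa> q)) w else 0)"

lemma chart_field_tangent:
  assumes U: "(U, \<kappa>) \<in> \<A>"
  shows "chart_field U \<kappa> a r w q \<in> tangent_space \<A> q"
proof (cases "q \<in> U")
  case True
  let ?D = "\<lambda>f. frechet_derivative (f \<circ> inv_into U \<kappa>) (at (\<kappa> q))"
  note D = chart_has_derivative[OF U _ True, unfolded comp_def]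
  have add: "?D (\<lambda>p. f p + h p) w = ?D f w + ?D h w"
    if "smooth_fun \<A> f" "smooth_fun \<A> h" for f h
    unfolding comp_def
    by (subst frechet_derivative_at[OF has_derivative_add[OF D[OF that(1)] D[OF that(2)]], symmetric]) simp
  have mult: "?D (\<lambda>p. f p * h p) w = f q * ?D h w + h q * ?D f w"
    if "smooth_fun \<A> f" "smooth_fun \<A> h" for f h
    unfolding comp_def
    by (subst frechet_derivative_at[OF has_derivative_mult[OF D[OF that(1)] D[OF that(2)]], symmetric])
      (simp add: chart_inverse[OF U True])
  have const: "?D (\<lambda>p. c) w = 0" for c
    by (simp add: comp_def frechet_derivative_const)
  show ?thesis
    by (rule tangent_spaceI)
      (simp_all add: chart_field_def True smooth_add smooth_mult smooth_const add mult const algebra_simps)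
next
  case False
  then have "chart_field U \<kappa> a r w q = 0"
    by (simp add: chart_field_def fun_eq_iff)
  then show ?thesis by (simp add: tangent_space_zero)
qed

text \<open>Seen in another chart, the field near a point of \<open>U\<close> is a smooth function
  composed with the transition map; near a point outside \<open>U\<close> it is 0.\<close>

lemma chart_field_smooth:
  assumes U: "(U, \<kappa>) \<in> \<A>" and r: "r > 0" and ball: "cball a r \<subseteq> \<kappa> ` U"
    and f: "smooth_fun \<A> f"
  shows "smooth_fun \<A> (\<lambda>q. chart_field U \<kappa> a r w q f)"
  unfolding smooth_fun_iff
proof (intro allI impI Ck_on_cover)
  fix V \<mu> k x
  assume V: "(V, \<mu>) \<in> \<A>" and "x \<in> \<mu> ` V"
  then obtain q where q: "q \<in> V" "x = \<mu> q" by blast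
  let ?F = "(\<lambda>q. chart_field U \<kappa> a r w q f) \<circ> inv_into V \<mu>"
  let ?G = "\<lambda>y. bump a r y * frechet_derivative (f \<circ> inv_into U \<kappa>) (at y) w"
  show "\<exists>T. open T \<and> x \<in> T \<and> Ck_on k T ?F"
  proof (cases "q \<in> U")
    case True
    have T: "open (\<mu> ` (V \<inter> U))"
      using chart_image_open_subset[OF V] chart_open[OF U] chart_open[OF V] by auto
    have "Ck_on (Suc k) (\<kappa> ` U) (f \<circ> inv_into U \<kappa>)"
      using f U unfolding smooth_fun_iff by blast
    then have G: "Ck_on k (\<kappa> ` U) ?G"
      by (intro Ck_on_bilinear[OF bounded_bilinear_mult] chart_image_open[OF U] Ck_on_bump) auto
    have "Ck_on k (\<mu> ` (V \<inter> U)) (\<lambda>x. ?G ((\<kappa> \<circ> inv_into V \<mu>) x))"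
      using charts_compatible[OF V U]
      by (intro Ck_on_compose[OF T chart_image_open[OF U] _ G])
        (auto simp: smooth_on_def chart_inverse[OF V] comp_def)
    then have "Ck_on k (\<mu> ` (V \<inter> U)) ?F"
      by (rule Ck_on_cong[OF T, rotated])
        (auto simp: chart_field_def chart_inverse[OF V] f)
    then show ?thesis
      using T True q by blast
  next
    case False
    let ?K = "inv_into U \<kappa> ` cball a r"
    \<comment> \<open>The field vanishes off the compact set \<open>?K\<close>, which is closed
      because the manifold is Hausdorff. Its complement is therefore a neighbourhood of
      \<open>q\<close>.\<close>
    have "continuous_on (\<kappa> ` U) (inv_into U \<kappa>)"
      using chart_homeomorphism[OF U] by (simp add: homeomorphism_def)
    then have "compact ?K"
      using compact_continuous_image[OF continuous_on_subset[OF _ ball] compact_cball] by simp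
    then have "open (\<mu> ` (V - ?K))"
      using chart_open[OF V] by (intro chart_image_open_subset[OF V] open_Diff compact_imp_closed) auto
    moreover have "?K \<subseteq> U"
      using ball inv_into_into[of _ \<kappa> U] by blast
    with False q have "x \<in> \<mu> ` (V - ?K)" by blast
    moreover have "chart_field U \<kappa> a r w q' f = 0" if "q' \<notin> ?K" for q'
    proof (cases "q' \<in> U")
      case True
      with that have "\<kappa> q' \<notin> cball a r"
        using chart_inverse[OF U True] by force
      then show ?thesis by (simp add: chart_field_def bump_outside[OF r])
    qed (simp add: chart_field_def)
    then have "Ck_on k (\<mu> ` (V - ?K)) ?F"
      by (intro Ck_on_cong[OF calculation(1) _ Ck_on_const[of _ _ 0]])
        (auto simp: chart_inverse[OF V])
    ultimately show ?thesis by blast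
  qed
qed

lemma chart_field:
  "\<lbrakk>(U, \<kappa>) \<in> \<A>; r > 0; cball a r \<subseteq> \<kappa> ` U\<rbrakk> \<Longrightarrow> vector_field \<A> (chart_field U \<kappa> a r w)"
  by (simp add: vector_field_def vf_apply_def chart_field_tangent chart_field_smooth)

text \<open>Cut-off coordinate fields turn the hypothesis on global fields into vanishing of all
  derivatives in charts. The function is then locally constant, and connectedness finishes.\<close>

lemma constant_if_fields_vanish:
  assumes conn: "connected (UNIV :: 'm set)" and f: "smooth_fun \<A> f"
    and zero: "\<And>X p. vector_field \<A> X \<Longrightarrow> X p f = 0"
  shows "f p = f q"
proof (rule connected_local_const[OF conn UNIV_I UNIV_I], rule ballI)
  fix p
  have "p \<in> (\<Union>(U, \<kappa>)\<in>\<A>. U)"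
    by (simp add: charts_cover)
  then obtain U \<kappa> where U: "(U, \<kappa>) \<in> \<A>" and p: "p \<in> U" by auto
  let ?h = "f \<circ> inv_into U \<kappa>"
  have deriv: "(?h has_derivative (\<lambda>w. 0)) (at x)" if x: "x \<in> \<kappa> ` U" for x
  proof -
    from x obtain q where q: "q \<in> U" "x = \<kappa> q" by blast
    obtain r where r: "r > 0" "cball x r \<subseteq> \<kappa> ` U"
      using bspec[OF chart_image_open[OF U, unfolded open_contains_cball] x] by blast
    \<comment> \<open>The field is centred at \<open>x\<close> itself, where the bump factor is
      nonzero and can be cancelled.\<close>
    have "frechet_derivative ?h (at x) w = 0" for w
      using zero[OF chart_field[OF U r, of w], of q] bump_center[OF r(1), of x] f q
      by (simp add: chart_field_def)
    then have "frechet_derivative ?h (at x) = (\<lambda>w. 0)" by (rule ext)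
    then show ?thesis
      using chart_has_derivative[OF U f q(1)] q(2) by simp
  qed
  obtain r where r: "r > 0" "ball (\<kappa> p) r \<subseteq> \<kappa> ` U"
    using chart_image_open[OF U, unfolded open_contains_ball] p by auto
  \<comment> \<open>A zero derivative forces constancy on a ball, which is convex; the chart image
    need not be.\<close>
  have same: "f p = f q" if "q \<in> U" "\<kappa> q \<in> ball (\<kappa> p) r" for q
  proof -
    have "(?h has_derivative (\<lambda>w. 0)) (at x within ball (\<kappa> p) r)"
      if "x \<in> ball (\<kappa> p) r" for x
      by (rule has_derivative_at_withinI[OF deriv[OF subsetD[OF r(2) that]]])
    then have "?h (\<kappa> q) = ?h (\<kappa> p)"
      by (rule has_derivative_zero_unique[OF convex_ball])
        (use r(1) that(2) in simp_all)
    then show ?thesis by (simp add: chart_inverse[OF U] p that(1))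
  qed
  have "continuous_on U \<kappa>"
    using chart_homeomorphism[OF U] by (simp add: homeomorphism_def)
  then have "open (\<kappa> -` ball (\<kappa> p) r \<inter> U)"
    by (simp add: continuous_on_open_vimage[OF chart_open[OF U]])
  then show "\<forall>\<^sub>F q in at p. f p = f q"
    unfolding eventually_at_topological
    by (intro exI[of _ "\<kappa> -` ball (\<kappa> p) r \<inter> U"] conjI ballI impI same) (use p r(1) in auto)
qed

section \<open>Linear maps on tangent spaces and the metric\<close>

lemma linear_on_tangent_add:
  "\<lbrakk>linear_on_tangent \<A> p L; v \<in> tangent_space \<A> p; w \<in> tangent_space \<A> p\<rbrakk>
    \<Longrightarrow> L (v + w) = L v + L w"
  by (simp add: linear_on_tangent_def)

lemma linear_on_tangent_scaleR:
  "\<lbrakk>linear_on_tangent \<A> p L; v \<in> tangent_space \<A> p\<rbrakk> \<Longrightarrow> L (c *\<^sub>R v) = c *\<^sub>R L v"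
  by (simp add: linear_on_tangent_def)

lemma linear_on_tangent_zero: "linear_on_tangent \<A> p L \<Longrightarrow> L 0 = 0"
  using linear_on_tangent_scaleR[of p L 0 0] tangent_space_zero by simp

lemma linear_on_tangent_uminus:
  "\<lbrakk>linear_on_tangent \<A> p L; v \<in> tangent_space \<A> p\<rbrakk> \<Longrightarrow> L (- v) = - L v"
  using linear_on_tangent_scaleR[of p L v "-1"] by simp

lemma linear_on_tangent_diff:
  "\<lbrakk>linear_on_tangent \<A> p L; v \<in> tangent_space \<A> p; w \<in> tangent_space \<A> p\<rbrakk>
    \<Longrightarrow> L (v - w) = L v - L w"
  using linear_on_tangent_add[of p L v "- w"]
  by (simp add: linear_on_tangent_uminus tangent_space_uminus)

lemmas linear_on_tangent_simps = linear_on_tangent_add linear_on_tangent_scaleR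
  linear_on_tangent_zero linear_on_tangent_uminus linear_on_tangent_diff

lemmas tangent_space_intros = tangent_space_zero tangent_space_add tangent_space_scaleR
  tangent_space_uminus tangent_space_diff

lemma lie_bracket_tangent:
  "\<lbrakk>vector_field \<A> X; vector_field \<A> Y\<rbrakk> \<Longrightarrow> lie_bracket X Y p \<in> tangent_space \<A> p"
  by (rule vector_field_tangent[OF lie_bracket_field])

lemma lie_bracket_zero: "vector_field \<A> X \<Longrightarrow> lie_bracket X 0 p = 0"
  by (simp add: lie_bracket_def vf_apply_def fun_eq_iff tangent_const[OF vector_field_tangent])

lemma metric_linear:
  assumes "riemannian_metric \<A> g" and "v \<in> tangent_space \<A> p"
  shows "linear_on_tangent \<A> p (g p v)" and "linear_on_tangent \<A> p (\<lambda>w. g p w v)"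
  using assms by (simp_all add: riemannian_metric_def)

lemma metric_sym:
  "\<lbrakk>riemannian_metric \<A> g; v \<in> tangent_space \<A> p; w \<in> tangent_space \<A> p\<rbrakk> \<Longrightarrow> g p v w = g p w v"
  by (simp add: riemannian_metric_def)

lemma metric_smooth:
  "\<lbrakk>riemannian_metric \<A> g; vector_field \<A> X; vector_field \<A> Y\<rbrakk>
    \<Longrightarrow> smooth_fun \<A> (\<lambda>p. g p (X p) (Y p))"
  by (simp add: riemannian_metric_def)

lemma metric_self_eq_0:
  assumes "riemannian_metric \<A> g" and "v \<in> tangent_space \<A> p" and "g p v v = 0"
  shows "v = 0"
proof (rule ccontr)
  assume "v \<noteq> 0"
  then have "0 < g p v v"
    using assms(1,2) unfolding riemannian_metric_def by blast
  with assms(3) show False by simp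
qed

section \<open>Killing fields\<close>

text \<open>This is \<open>L_K g = 0\<close> tested on global fields; it involves brackets and
  derivatives of functions but no connection.\<close>

definition killing_field :: "('m \<Rightarrow> 'm tvec \<Rightarrow> 'm tvec \<Rightarrow> real) \<Rightarrow> 'm vfield \<Rightarrow> bool"
  where "killing_field g K \<longleftrightarrow> vector_field \<A> K \<and>
    (\<forall>Y Z p. vector_field \<A> Y \<and> vector_field \<A> Z \<longrightarrow>
      K p (\<lambda>q. g q (Y q) (Z q)) = g p (lie_bracket K Y p) (Z p) + g p (Y p) (lie_bracket K Z p))"

lemma killing_fieldD:
  "\<lbrakk>killing_field g K; vector_field \<A> Y; vector_field \<A> Z\<rbrakk> \<Longrightarrow>
    K p (\<lambda>q. g q (Y q) (Z q)) = g p (lie_bracket K Y p) (Z p) + g p (Y p) (lie_bracket K Z p)"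
  by (simp add: killing_field_def)

lemma killing_field_vector_field: "killing_field g K \<Longrightarrow> vector_field \<A> K"
  by (simp add: killing_field_def)

text \<open>Apply the two Killing equations in succession, in both orders. In the difference the
  mixed terms of \<open>second\<close> cancel, being symmetric in \<open>A\<close> and
  \<open>B\<close>, and the Jacobi identity collects the rest.\<close>

lemma killing_lie_bracket:
  assumes g: "riemannian_metric \<A> g" and K: "killing_field g K" and L: "killing_field g L"
  shows "killing_field g (lie_bracket K L)"
  unfolding killing_field_def
proof (intro conjI allI impI)
  note f = killing_field_vector_field[OF K] killing_field_vector_field[OF L]
  show "vector_field \<A> (lie_bracket K L)"
    using f by (rule lie_bracket_field)
  fix Y Z p
  assume "vector_field \<A> Y \<and> vector_field \<A> Z"
  then have Y: "vector_field \<A> Y" and Z: "vector_field \<A> Z" by auto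
  note m = metric_linear[OF g]
  have second: "A p (\<lambda>q. B q (\<lambda>q. g q (Y q) (Z q)))
      = g p (lie_bracket A (lie_bracket B Y) p) (Z p) + g p (lie_bracket B Y p) (lie_bracket A Z p)
      + (g p (lie_bracket A Y p) (lie_bracket B Z p) + g p (Y p) (lie_bracket A (lie_bracket B Z) p))"
    if A: "killing_field g A" and B: "killing_field g B" for A B
  proof -
    note fA = killing_field_vector_field[OF A] and fB = killing_field_vector_field[OF B]
    note t = vector_field_tangent[OF fA]
    have "A p (\<lambda>q. B q (\<lambda>q. g q (Y q) (Z q)))
        = A p (\<lambda>q. g q (lie_bracket B Y q) (Z q) + g q (Y q) (lie_bracket B Z q))"
      by (simp only: killing_fieldD[OF B Y Z])
    also have "\<dots> = A p (\<lambda>q. g q (lie_bracket B Y q) (Z q)) + A p (\<lambda>q. g q (Y q) (lie_bracket B Z q))"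
      by (rule tangent_add[OF t metric_smooth[OF g lie_bracket_field[OF fB Y] Z]
            metric_smooth[OF g Y lie_bracket_field[OF fB Z]]])
    finally show ?thesis
      by (simp only: killing_fieldD[OF A lie_bracket_field[OF fB Y] Z]
          killing_fieldD[OF A Y lie_bracket_field[OF fB Z]])
  qed
  have "lie_bracket K L p (\<lambda>q. g q (Y q) (Z q))
      = K p (\<lambda>q. L q (\<lambda>q. g q (Y q) (Z q))) - L p (\<lambda>q. K q (\<lambda>q. g q (Y q) (Z q)))"
    by (simp add: lie_bracket_def vf_apply_def)
  then show "lie_bracket K L p (\<lambda>q. g q (Y q) (Z q))
      = g p (lie_bracket (lie_bracket K L) Y p) (Z p) + g p (Y p) (lie_bracket (lie_bracket K L) Z p)"
    by (simp add: second[OF K L] second[OF L K] lie_bracket_jacobi[OF f Y] lie_bracket_jacobi[OF f Z]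
        linear_on_tangent_diff[OF m(1)[OF vector_field_tangent[OF Y]]]
        linear_on_tangent_diff[OF m(2)[OF vector_field_tangent[OF Z]]]
        lie_bracket_tangent lie_bracket_field f Y Z)
qed

text \<open>
  \<open>L\<^bsub>fK\<^esub> g = df \<otimes> K\<^sup>\<flat> + K\<^sup>\<flat> \<otimes> df\<close> vanishes; evaluating on \<open>(K, K)\<close> and then on
  \<open>(X, K)\<close> gives \<open>df = 0\<close>.
\<close>

lemma killing_multiple_imp_derivative_zero:
  assumes g: "riemannian_metric \<A> g" and K: "killing_field g K"
    and unit: "\<And>p. g p (K p) (K p) = 1" and f: "smooth_fun \<A> f"
    and fK: "killing_field g (\<lambda>p. f p *\<^sub>R K p)" and X: "vector_field \<A> X"
  shows "X p f = 0"
proof -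
  note fieldK = killing_field_vector_field[OF K]
  have sum: "Y p f * g p (K p) (Z p) + Z p f * g p (Y p) (K p) = 0"
    if Y: "vector_field \<A> Y" and Z: "vector_field \<A> Z" for Y Z
  proof -
    note tY = vector_field_tangent[OF Y] and tZ = vector_field_tangent[OF Z]
      and tK = vector_field_tangent[OF fieldK]
    have "(f p *\<^sub>R K p) (\<lambda>q. g q (Y q) (Z q)) = f p * K p (\<lambda>q. g q (Y q) (Z q))"
      by (simp add: scaleR_fun_def)
    then have "f p * (g p (lie_bracket K Y p) (Z p) + g p (Y p) (lie_bracket K Z p))
        = g p (f p *\<^sub>R lie_bracket K Y p - Y p f *\<^sub>R K p) (Z p)
        + g p (Y p) (f p *\<^sub>R lie_bracket K Z p - Z p f *\<^sub>R K p)"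
      by (simp only: killing_fieldD[OF K Y Z] killing_fieldD[OF fK Y Z]
          lie_bracket_scale[OF f fieldK Y] lie_bracket_scale[OF f fieldK Z])
    also have "\<dots> = f p * g p (lie_bracket K Y p) (Z p) - Y p f * g p (K p) (Z p)
        + (f p * g p (Y p) (lie_bracket K Z p) - Z p f * g p (Y p) (K p))"
      by (simp add: linear_on_tangent_diff[OF metric_linear(1)[OF g tY]]
          linear_on_tangent_diff[OF metric_linear(2)[OF g tZ]]
          linear_on_tangent_scaleR[OF metric_linear(1)[OF g tY]]
          linear_on_tangent_scaleR[OF metric_linear(2)[OF g tZ]]
          tangent_space_scaleR lie_bracket_tangent fieldK Y Z tK)
    finally show ?thesis by (simp add: algebra_simps)
  qed
  have "K p f = 0" using sum[OF fieldK fieldK] by (simp add: unit)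
  then show ?thesis using sum[OF X fieldK] by (simp add: unit)
qed

end

section \<open>Quasi-Sasakian structures\<close>

context almost_contact_structure
begin

lemma phi_tangent: "v \<in> tangent_space \<A> p \<Longrightarrow> \<phi> p v \<in> tangent_space \<A> p"
  using phi_endo by (auto simp: endo_field_def)

lemma phi_linear: "linear_on_tangent \<A> p (\<phi> p)"
  using phi_endo by (simp add: endo_field_def)

lemma eta_linear: "linear_on_tangent \<A> p (\<eta> p)"
  using eta_form by (simp add: one_form_def)

lemma phi_vector_field: "vector_field \<A> X \<Longrightarrow> vector_field \<A> (\<lambda>p. \<phi> p (X p))"
  using phi_endo by (simp add: endo_field_def endo_apply_def)

lemma eta_smooth: "vector_field \<A> X \<Longrightarrow> smooth_fun \<A> (\<lambda>p. \<eta> p (X p))"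
  using eta_form by (simp add: one_form_def)

lemma xi_tangent: "\<xi> p \<in> tangent_space \<A> p"
  by (rule vector_field_tangent[OF xi_field])

lemmas phi_simps = linear_on_tangent_simps[OF phi_linear]
lemmas eta_simps = linear_on_tangent_simps[OF eta_linear]

lemma xi_nonzero: "\<xi> p \<noteq> 0"
  using eta_xi[of p] eta_simps(3)[of p] by auto

text \<open>As \<open>\<phi> (\<phi> \<xi>) = 0\<close>, the formula for \<open>\<phi>\<close>
  squared at \<open>\<phi> \<xi>\<close> gives
  \<open>\<phi> \<xi> = \<eta>(\<phi> \<xi>) \<xi>\<close>. Applying \<open>\<phi>\<close> shows
  that this coefficient or \<open>\<phi> \<xi>\<close> vanishes, and either suffices.\<close>

lemma phi_reeb: "\<phi> p (\<xi> p) = 0"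
proof -
  note t = phi_tangent[OF xi_tangent]
  have "\<phi> p (\<phi> p (\<xi> p)) = 0"
    by (simp add: phi_sq[OF xi_tangent] eta_xi)
  then have "\<eta> p (\<phi> p (\<xi> p)) *\<^sub>R \<xi> p = \<phi> p (\<xi> p)"
    using phi_sq[OF t, of p] by (simp only: phi_simps(3)) simp
  then have "\<eta> p (\<phi> p (\<xi> p)) *\<^sub>R \<phi> p (\<xi> p) = 0"
    using \<open>\<phi> p (\<phi> p (\<xi> p)) = 0\<close> phi_simps(2)[OF xi_tangent] by metis
  then show ?thesis
    by (auto simp: eta_simps)
      (use \<open>\<eta> p (\<phi> p (\<xi> p)) *\<^sub>R \<xi> p = \<phi> p (\<xi> p)\<close> in auto)
qed

text \<open>Compute the third power of \<open>\<phi>\<close> at \<open>v\<close> in two ways: the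
  results differ by \<open>\<eta>(\<phi> v) \<xi>\<close>, and \<open>\<xi>\<close> is
  nonzero.\<close>

lemma eta_phi_eq_0:
  assumes "v \<in> tangent_space \<A> p"
  shows "\<eta> p (\<phi> p v) = 0"
proof -
  have "\<phi> p (\<phi> p (\<phi> p v)) = - \<phi> p v"
    by (simp add: phi_sq[OF assms] phi_simps phi_reeb tangent_space_intros assms xi_tangent)
  then show ?thesis
    using phi_sq[OF phi_tangent[OF assms]] xi_nonzero by simp
qed

end

text \<open>Isolates what follows from one structure and its metric, to be interpreted for each of
  the three.\<close>

locale quasi_sasakian = almost_contact_structure \<A> \<phi> \<xi> \<eta>
  for \<A> :: "('m::{t2_space, second_countable_topology}, 'e::euclidean_space) chart set"
    and \<phi> \<xi> \<eta> +
  fixes g :: "'m \<Rightarrow> 'm tvec \<Rightarrow> 'm tvec \<Rightarrow> real"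
  assumes riemannian: "riemannian_metric \<A> g"
    and compatible: "compatible_metric \<A> \<phi> \<eta> g"
    and normal: "normal_structure \<A> \<phi> \<xi> \<eta>"
    and closed: "closed_2form \<A> (fundamental_form \<phi> g)"
begin

lemma metric_phi_phi:
  "\<lbrakk>v \<in> tangent_space \<A> p; w \<in> tangent_space \<A> p\<rbrakk>
    \<Longrightarrow> g p (\<phi> p v) (\<phi> p w) = g p v w - \<eta> p v * \<eta> p w"
  using compatible by (simp add: compatible_metric_def)

lemma metric_reeb:
  assumes "v \<in> tangent_space \<A> p"
  shows "g p v (\<xi> p) = \<eta> p v"
  using metric_phi_phi[OF assms xi_tangent]
    linear_on_tangent_zero[OF metric_linear(1)[OF riemannian phi_tangent[OF assms]]]
  by (simp add: phi_reeb eta_xi)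

text \<open>Apply compatibility to \<open>v\<close> and \<open>\<phi> w\<close>, then expand
  \<open>\<phi> (\<phi> w)\<close>; both correction terms vanish by
  \<open>\<eta> \<circ> \<phi> = 0\<close>.\<close>

lemma metric_phi_skew:
  assumes v: "v \<in> tangent_space \<A> p" and w: "w \<in> tangent_space \<A> p"
  shows "g p (\<phi> p v) w = - g p v (\<phi> p w)"
proof -
  note m = linear_on_tangent_simps[OF metric_linear(1)[OF riemannian phi_tangent[OF v]]]
  have "g p v (\<phi> p w) = g p (\<phi> p v) (\<phi> p (\<phi> p w))"
    by (simp add: metric_phi_phi v phi_tangent[OF w] eta_phi_eq_0 w)
  also have "\<dots> = - g p (\<phi> p v) w"
    by (simp add: phi_sq[OF w] m tangent_space_intros w xi_tangent metric_reeb phi_tangent v eta_phi_eq_0)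
  finally show ?thesis by simp
qed

text \<open>\<open>N\<^sup>1(X, \<xi>) = 0\<close>, after \<open>\<phi>\<^sup>2[X, \<xi>]\<close> and \<open>2 d\<eta>(X, \<xi>)\<close> have been expanded.\<close>

lemma normal_reeb:
  assumes X: "vector_field \<A> X"
  shows "lie_bracket X \<xi> p + \<phi> p (lie_bracket (\<lambda>q. \<phi> q (X q)) \<xi> p)
    + \<xi> p (\<lambda>q. \<eta> q (X q)) *\<^sub>R \<xi> p = 0"
proof -
  have reeb: "endo_apply \<phi> \<xi> = 0"
    by (simp add: endo_apply_def phi_reeb fun_eq_iff)
  have d: "2 * ext_deriv1 \<eta> X \<xi> p = - \<xi> p (\<lambda>q. \<eta> q (X q)) - \<eta> p (lie_bracket X \<xi> p)"
    by (simp add: ext_deriv1_def eta_xi tangent_const[OF vector_field_tangent[OF X]])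
  have N: "nijenhuis \<phi> X \<xi> p = - lie_bracket X \<xi> p + \<eta> p (lie_bracket X \<xi> p) *\<^sub>R \<xi> p
      - \<phi> p (lie_bracket (\<lambda>q. \<phi> q (X q)) \<xi> p)"
    unfolding nijenhuis_def reeb
    by (simp add: endo_apply_def lie_bracket_zero X phi_vector_field phi_simps
        phi_sq lie_bracket_tangent xi_field) (simp add: fun_eq_iff)
  have "nijenhuis \<phi> X \<xi> p + (2 * ext_deriv1 \<eta> X \<xi> p) *\<^sub>R \<xi> p = 0"
    using normal X xi_field by (simp add: normal_structure_def)
  then have "- (lie_bracket X \<xi> p + \<phi> p (lie_bracket (\<lambda>q. \<phi> q (X q)) \<xi> p)
      + \<xi> p (\<lambda>q. \<eta> q (X q)) *\<^sub>R \<xi> p) = 0"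
    by (simp only: N d) (simp add: scaleR_diff_left algebra_simps)
  then show ?thesis by (simp only: neg_equal_0_iff_equal)
qed

text \<open>Apply \<open>\<eta>\<close> to \<open>normal_reeb\<close>: the middle term dies by
  \<open>\<eta> \<circ> \<phi> = 0\<close>. The result is \<open>L_\<xi> \<eta> = 0\<close>.\<close>

lemma eta_lie_bracket:
  assumes X: "vector_field \<A> X"
  shows "\<xi> p (\<lambda>q. \<eta> q (X q)) = \<eta> p (lie_bracket \<xi> X p)"
proof -
  note t = lie_bracket_tangent[OF X xi_field, of p]
    phi_tangent[OF lie_bracket_tangent[OF phi_vector_field[OF X] xi_field, of p]]
    tangent_space_scaleR[OF xi_tangent]
  have "\<eta> p (lie_bracket X \<xi> p) + \<xi> p (\<lambda>q. \<eta> q (X q)) = 0"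
    using arg_cong[OF normal_reeb[OF X, of p], of "\<eta> p"] t
    by (simp add: eta_simps tangent_space_add xi_tangent eta_xi
        eta_phi_eq_0 lie_bracket_tangent phi_vector_field X xi_field)
  then show ?thesis
    by (subst lie_bracket_swap) (simp add: eta_simps t)
qed

text \<open>Apply \<open>\<phi>\<close> to \<open>normal_reeb\<close>, which kills the
  \<open>\<xi>\<close> term. The square of \<open>\<phi>\<close> acts on \<open>?C\<close> as
  \<open>-1\<close>, because \<open>L_\<xi> \<eta> = 0\<close> at \<open>\<phi> X\<close> gives
  \<open>\<eta> ?C = 0\<close>. The result is \<open>L_\<xi> \<phi> = 0\<close>.\<close>

lemma phi_lie_bracket:
  assumes X: "vector_field \<A> X"
  shows "lie_bracket \<xi> (\<lambda>q. \<phi> q (X q)) p = \<phi> p (lie_bracket \<xi> X p)"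
proof -
  let ?B = "lie_bracket X \<xi> p" and ?C = "lie_bracket (\<lambda>q. \<phi> q (X q)) \<xi> p"
  have B: "?B \<in> tangent_space \<A> p" and C: "?C \<in> tangent_space \<A> p"
    by (intro lie_bracket_tangent phi_vector_field X xi_field)+
  have "\<eta> p (lie_bracket \<xi> (\<lambda>q. \<phi> q (X q)) p) = 0"
    using eta_lie_bracket[OF phi_vector_field[OF X], of p]
    by (simp add: eta_phi_eq_0 vector_field_tangent[OF X] tangent_const[OF xi_tangent])
  then have "\<eta> p ?C = 0"
    by (subst (asm) lie_bracket_swap) (simp add: eta_simps C)
  moreover have "\<phi> p ?B + \<phi> p (\<phi> p ?C) = 0"
    using arg_cong[OF normal_reeb[OF X, of p], of "\<phi> p"]
    by (simp add: phi_simps tangent_space_intros B C phi_tangent xi_tangent phi_reeb)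
  ultimately have "?C = \<phi> p ?B"
    by (simp add: phi_sq[OF C])
  then show ?thesis
    by (simp add: lie_bracket_swap[of \<xi>] phi_simps B)
qed

text \<open>Contracting the fundamental form with \<open>\<xi>\<close> gives 0, so its closedness
  amounts to invariance under \<open>\<xi>\<close>. Since \<open>\<phi>\<close> is invariant as
  well, the Killing equation follows for pairs \<open>Y\<close>, \<open>\<phi> Z\<close>.\<close>

lemma killing_phi:
  assumes Y: "vector_field \<A> Y" and Z: "vector_field \<A> Z"
  shows "\<xi> p (\<lambda>q. g q (Y q) (\<phi> q (Z q)))
    = g p (lie_bracket \<xi> Y p) (\<phi> p (Z p)) + g p (Y p) (lie_bracket \<xi> (\<lambda>q. \<phi> q (Z q)) p)"
proof -
  note t = vector_field_tangent[OF Y] vector_field_tangent[OF Z]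
    and fields = xi_field Y Z
  have reeb: "g q v (\<phi> q (\<xi> q)) = 0" "g q (\<xi> q) (\<phi> q v) = 0"
    if v: "v \<in> tangent_space \<A> q" for q v
    using metric_sym[OF riemannian xi_tangent phi_tangent[OF v]]
      linear_on_tangent_zero[OF metric_linear(1)[OF riemannian v]]
    by (simp_all add: metric_reeb phi_tangent v eta_phi_eq_0 phi_reeb)
  \<comment> \<open>This is the last term of \<open>ext_deriv2\<close>, moved into the slot of the
    conclusion by skewness of \<open>\<phi>\<close>.\<close>
  have "g p (lie_bracket Z \<xi> p) (\<phi> p (Y p)) = g p (\<phi> p (Y p)) (lie_bracket Z \<xi> p)"
    by (rule metric_sym[OF riemannian lie_bracket_tangent[OF Z xi_field] phi_tangent[OF t(1)]])
  also have "\<dots> = - g p (Y p) (\<phi> p (lie_bracket Z \<xi> p))"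
    by (rule metric_phi_skew[OF t(1) lie_bracket_tangent[OF Z xi_field]])
  also have "\<dots> = g p (Y p) (\<phi> p (lie_bracket \<xi> Z p))"
    by (subst lie_bracket_swap) (simp add: phi_simps lie_bracket_tangent phi_tangent fields
        linear_on_tangent_uminus[OF metric_linear(1)[OF riemannian t(1)]])
  finally have "g p (lie_bracket Z \<xi> p) (\<phi> p (Y p)) = g p (Y p) (\<phi> p (lie_bracket \<xi> Z p))" .
  moreover have "ext_deriv2 (fundamental_form \<phi> g) \<xi> Y Z p = 0"
    using closed fields by (simp add: closed_2form_def)
  ultimately show ?thesis
    by (simp add: ext_deriv2_def fundamental_form_def reeb t phi_lie_bracket[OF Z]
        t[THEN tangent_const] lie_bracket_tangent fields)
qed

text \<open>Compatibility splits \<open>g(Y, Z)\<close> into \<open>g(\<phi> Y, \<phi> Z)\<close>,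
  covered by \<open>killing_phi\<close> at \<open>\<phi> Y\<close>, and
  \<open>\<eta>(Y) \<eta>(Z)\<close>, covered by \<open>L_\<xi> \<eta> = 0\<close>.\<close>

lemma killing: "killing_field g \<xi>"
  unfolding killing_field_def
proof (intro conjI allI impI)
  show "vector_field \<A> \<xi>" by (rule xi_field)
  fix Y Z p
  assume "vector_field \<A> Y \<and> vector_field \<A> Z"
  then have Y: "vector_field \<A> Y" and Z: "vector_field \<A> Z" by auto
  note t = vector_field_tangent[OF Y] vector_field_tangent[OF Z]
    lie_bracket_tangent[OF xi_field Y] lie_bracket_tangent[OF xi_field Z]
  have "\<xi> p (\<lambda>q. g q (Y q) (Z q))
      = \<xi> p (\<lambda>q. g q (\<phi> q (Y q)) (\<phi> q (Z q)) + \<eta> q (Y q) * \<eta> q (Z q))"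
    by (simp add: metric_phi_phi t)
  also have "\<dots> = \<xi> p (\<lambda>q. g q (\<phi> q (Y q)) (\<phi> q (Z q)))
      + (\<eta> p (Y p) * \<xi> p (\<lambda>q. \<eta> q (Z q)) + \<eta> p (Z p) * \<xi> p (\<lambda>q. \<eta> q (Y q)))"
    by (simp add: tangent_add[OF xi_tangent] tangent_mult[OF xi_tangent] smooth_mult eta_smooth Y Z
        metric_smooth[OF riemannian] phi_vector_field)
  also have "\<xi> p (\<lambda>q. g q (\<phi> q (Y q)) (\<phi> q (Z q)))
      = g p (\<phi> p (lie_bracket \<xi> Y p)) (\<phi> p (Z p)) + g p (\<phi> p (Y p)) (\<phi> p (lie_bracket \<xi> Z p))"
    by (simp only: killing_phi[OF phi_vector_field[OF Y] Z] phi_lie_bracket Y Z)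
  also have "\<dots> + (\<eta> p (Y p) * \<xi> p (\<lambda>q. \<eta> q (Z q)) + \<eta> p (Z p) * \<xi> p (\<lambda>q. \<eta> q (Y q)))
      = g p (lie_bracket \<xi> Y p) (Z p) + g p (Y p) (lie_bracket \<xi> Z p)"
    by (simp add: metric_phi_phi t eta_lie_bracket Y Z)
  finally show "\<xi> p (\<lambda>q. g q (Y q) (Z q))
      = g p (lie_bracket \<xi> Y p) (Z p) + g p (Y p) (lie_bracket \<xi> Z p)" .
qed

end

section \<open>The Reeb fields of a 3-quasi-Sasakian manifold\<close>

lemma even_perm3_cycle: "even_perm3 \<alpha> \<beta> \<gamma> \<Longrightarrow> even_perm3 \<beta> \<gamma> \<alpha>"
  by (auto simp: even_perm3_iff)

context three_quasi_sasakian
begin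

lemma quasi_sasakian:
  assumes "\<alpha> \<in> {1, 2, 3}"
  shows "quasi_sasakian \<A> (\<phi> \<alpha>) (\<xi> \<alpha>) (\<eta> \<alpha>) g"
  by (intro quasi_sasakian.intro quasi_sasakian_axioms.intro almost_contact metric
      metric_compatible hyper_normal fundamental_closed assms)

lemma quasi_sasakian_perm:
  assumes "even_perm3 \<alpha> \<beta> \<gamma>"
  shows "quasi_sasakian \<A> (\<phi> \<alpha>) (\<xi> \<alpha>) (\<eta> \<alpha>) g"
    and "quasi_sasakian \<A> (\<phi> \<beta>) (\<xi> \<beta>) (\<eta> \<beta>) g"
    and "quasi_sasakian \<A> (\<phi> \<gamma>) (\<xi> \<gamma>) (\<eta> \<gamma>) g"
  using assms by (auto simp: even_perm3_iff intro!: quasi_sasakian)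

lemma lie_bracket_reeb_vertical:
  assumes perm: "even_perm3 \<alpha> \<beta> \<gamma>"
  shows "lie_bracket (\<xi> \<beta>) (\<xi> \<gamma>) p = \<eta> \<alpha> p (lie_bracket (\<xi> \<beta>) (\<xi> \<gamma>) p) *\<^sub>R \<xi> \<alpha> p"
proof -
  interpret a: quasi_sasakian \<A> "\<phi> \<alpha>" "\<xi> \<alpha>" "\<eta> \<alpha>" g by (rule quasi_sasakian_perm(1)[OF perm])
  interpret b: quasi_sasakian \<A> "\<phi> \<beta>" "\<xi> \<beta>" "\<eta> \<beta>" g by (rule quasi_sasakian_perm(2)[OF perm])
  interpret c: quasi_sasakian \<A> "\<phi> \<gamma>" "\<xi> \<gamma>" "\<eta> \<gamma>" g by (rule quasi_sasakian_perm(3)[OF perm])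
  let ?B = "lie_bracket (\<xi> \<beta>) (\<xi> \<gamma>)"
  have B: "vector_field \<A> ?B"
    by (intro lie_bracket_field b.xi_field c.xi_field)
  note tB = vector_field_tangent[OF B]
  \<comment> \<open>For this test field skewness turns \<open>g(?B, \<phi> X)\<close> into
    \<open>- g(X, X)\<close>, so its vanishing puts \<open>?B\<close> in the kernel of
    \<open>\<phi> \<alpha>\<close>, which \<open>\<xi> \<alpha>\<close> spans.\<close>
  define X where "X = (\<lambda>q. \<phi> \<alpha> q (?B q))"
  have X: "vector_field \<A> X"
    unfolding X_def by (rule a.phi_vector_field[OF B])
  note tX = vector_field_tangent[OF X]
  have beta: "\<phi> \<alpha> q (\<xi> \<beta> q) = \<xi> \<gamma> q" for q
    using phi_xi(1)[OF perm] by simp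
  have gamma: "\<phi> \<alpha> q (\<xi> \<gamma> q) = - \<xi> \<beta> q" for q
    using phi_xi(2)[OF even_perm3_cycle[OF even_perm3_cycle[OF perm]]] by simp
  have g_beta: "g q v (\<phi> \<alpha> q (\<xi> \<beta> q)) = \<eta> \<gamma> q v" if "v \<in> tangent_space \<A> q" for q v
    by (simp add: beta c.metric_reeb that)
  have g_gamma: "g q v (\<phi> \<alpha> q (\<xi> \<gamma> q)) = - \<eta> \<beta> q v" if "v \<in> tangent_space \<A> q" for q v
    by (simp add: gamma linear_on_tangent_uminus[OF metric_linear(1)[OF metric that]]
        b.xi_tangent b.metric_reeb that)
  have g_gamma_X: "g q (\<xi> \<gamma> q) (\<phi> \<alpha> q (X q)) = \<eta> \<beta> q (X q)" for q
    using a.metric_phi_skew[OF c.xi_tangent tX, of q] g_gamma[OF tX, of q]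
      metric_sym[OF metric a.phi_tangent[OF c.xi_tangent] tX, of q] by linarith
  \<comment> \<open>Of the six terms of \<open>ext_deriv2\<close>, the derivative along
    \<open>X\<close> is that of the constant \<open>-1\<close>, and four cancel in pairs by
    invariance of \<open>\<eta> \<beta>\<close> and \<open>\<eta> \<gamma>\<close>. Only the term
    with \<open>?B\<close> survives.\<close>
  have "\<xi> \<gamma> p (\<lambda>q. g q (X q) (\<phi> \<alpha> q (\<xi> \<beta> q))) = \<eta> \<gamma> p (lie_bracket (\<xi> \<gamma>) X p)"
    by (simp add: g_beta tX c.eta_lie_bracket[OF X])
  moreover have "\<xi> \<beta> p (\<lambda>q. g q (\<xi> \<gamma> q) (\<phi> \<alpha> q (X q))) = \<eta> \<beta> p (lie_bracket (\<xi> \<beta>) X p)"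
    by (simp add: g_gamma_X b.eta_lie_bracket[OF X])
  moreover have "X p (\<lambda>q. g q (\<xi> \<beta> q) (\<phi> \<alpha> q (\<xi> \<gamma> q))) = 0"
    by (simp add: g_gamma b.xi_tangent b.eta_xi tangent_const[OF tX])
  moreover have "g p (lie_bracket (\<xi> \<gamma>) X p) (\<phi> \<alpha> p (\<xi> \<beta> p)) = \<eta> \<gamma> p (lie_bracket (\<xi> \<gamma>) X p)"
    by (intro g_beta lie_bracket_tangent c.xi_field X)
  moreover have "g p (lie_bracket X (\<xi> \<beta>) p) (\<phi> \<alpha> p (\<xi> \<gamma> p)) = \<eta> \<beta> p (lie_bracket (\<xi> \<beta>) X p)"
    by (simp add: g_gamma lie_bracket_tangent b.xi_field X lie_bracket_swap[of X] b.eta_simps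
        tangent_space_uminus)
  moreover have "ext_deriv2 (fundamental_form (\<phi> \<alpha>) g) (\<xi> \<beta>) (\<xi> \<gamma>) X p = 0"
    using a.closed X b.xi_field c.xi_field by (simp add: closed_2form_def)
  ultimately have "g p (?B p) (\<phi> \<alpha> p (X p)) = 0"
    by (simp add: ext_deriv2_def fundamental_form_def)
  then have "g p (X p) (X p) = 0"
    using a.metric_phi_skew[OF tB tX] by (simp add: X_def)
  then have "\<phi> \<alpha> p (?B p) = 0"
    using metric_self_eq_0[OF metric tX] by (simp add: X_def)
  then show ?thesis
    using a.phi_sq[OF tB, of p] by (simp add: a.phi_simps)
qed

text \<open>Reading the coefficient off with \<open>\<eta> \<gamma>\<close> makes its smoothness
  immediate.\<close>

definition reeb_coefficient :: "nat \<Rightarrow> nat \<Rightarrow> nat \<Rightarrow> 'm \<Rightarrow> real"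
  where "reeb_coefficient \<alpha> \<beta> \<gamma> p = \<eta> \<gamma> p (lie_bracket (\<xi> \<alpha>) (\<xi> \<beta>) p)"

lemma lie_bracket_reeb:
  "even_perm3 \<alpha> \<beta> \<gamma> \<Longrightarrow>
    lie_bracket (\<xi> \<alpha>) (\<xi> \<beta>) p = reeb_coefficient \<alpha> \<beta> \<gamma> p *\<^sub>R \<xi> \<gamma> p"
  unfolding reeb_coefficient_def
  by (rule lie_bracket_reeb_vertical[OF even_perm3_cycle[OF even_perm3_cycle]])

text \<open>Applying \<open>L\<^bsub>\<xi>\<^sub>\<alpha>\<^esub> \<phi>\<^sub>\<alpha> = 0\<close> to \<open>\<xi>\<^sub>\<gamma> = \<phi>\<^sub>\<alpha> \<xi>\<^sub>\<beta>\<close> relates \<open>[\<xi>\<^sub>\<alpha>, \<xi>\<^sub>\<gamma>]\<close> to \<open>[\<xi>\<^sub>\<alpha>, \<xi>\<^sub>\<beta>]\<close>.\<close>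

lemma reeb_coefficient_cycle:
  assumes perm: "even_perm3 \<alpha> \<beta> \<gamma>"
  shows "reeb_coefficient \<gamma> \<alpha> \<beta> p = reeb_coefficient \<alpha> \<beta> \<gamma> p"
proof -
  interpret a: quasi_sasakian \<A> "\<phi> \<alpha>" "\<xi> \<alpha>" "\<eta> \<alpha>" g by (rule quasi_sasakian_perm(1)[OF perm])
  interpret b: quasi_sasakian \<A> "\<phi> \<beta>" "\<xi> \<beta>" "\<eta> \<beta>" g by (rule quasi_sasakian_perm(2)[OF perm])
  interpret c: quasi_sasakian \<A> "\<phi> \<gamma>" "\<xi> \<gamma>" "\<eta> \<gamma>" g by (rule quasi_sasakian_perm(3)[OF perm])
  have perm': "even_perm3 \<gamma> \<alpha> \<beta>"
    by (rule even_perm3_cycle[OF even_perm3_cycle[OF perm]])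
  have beta: "(\<lambda>q. \<phi> \<alpha> q (\<xi> \<beta> q)) = \<xi> \<gamma>"
    using phi_xi(1)[OF perm] by (simp add: fun_eq_iff)
  have gamma: "\<phi> \<alpha> p (\<xi> \<gamma> p) = - \<xi> \<beta> p"
    using phi_xi(2)[OF perm'] by simp
  have "lie_bracket (\<xi> \<alpha>) (\<xi> \<gamma>) p = \<phi> \<alpha> p (lie_bracket (\<xi> \<alpha>) (\<xi> \<beta>) p)"
    using a.phi_lie_bracket[OF b.xi_field] by (simp only: beta)
  then have "lie_bracket (\<xi> \<alpha>) (\<xi> \<gamma>) p = - (reeb_coefficient \<alpha> \<beta> \<gamma> p *\<^sub>R \<xi> \<beta> p)"
    by (simp add: lie_bracket_reeb[OF perm] a.phi_simps c.xi_tangent gamma)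
  moreover have "lie_bracket (\<xi> \<alpha>) (\<xi> \<gamma>) p = - (reeb_coefficient \<gamma> \<alpha> \<beta> p *\<^sub>R \<xi> \<beta> p)"
    by (simp only: lie_bracket_reeb[OF perm'] lie_bracket_swap[of "\<xi> \<alpha>" "\<xi> \<gamma>"])
  ultimately show ?thesis
    using b.xi_nonzero by simp
qed

lemma reeb_coefficient_smooth:
  assumes perm: "even_perm3 \<alpha> \<beta> \<gamma>"
  shows "smooth_fun \<A> (reeb_coefficient \<alpha> \<beta> \<gamma>)"
proof -
  interpret a: quasi_sasakian \<A> "\<phi> \<alpha>" "\<xi> \<alpha>" "\<eta> \<alpha>" g by (rule quasi_sasakian_perm(1)[OF perm])
  interpret b: quasi_sasakian \<A> "\<phi> \<beta>" "\<xi> \<beta>" "\<eta> \<beta>" g by (rule quasi_sasakian_perm(2)[OF perm])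
  interpret c: quasi_sasakian \<A> "\<phi> \<gamma>" "\<xi> \<gamma>" "\<eta> \<gamma>" g by (rule quasi_sasakian_perm(3)[OF perm])
  show ?thesis
    unfolding reeb_coefficient_def[abs_def]
    by (intro c.eta_smooth lie_bracket_field a.xi_field b.xi_field)
qed

text \<open>The bracket of two Killing fields is Killing and here is a multiple of the unit Killing
  field \<open>\<xi> \<gamma>\<close>; hence every vector field annihilates the coefficient.\<close>

lemma reeb_coefficient_constant:
  assumes perm: "even_perm3 \<alpha> \<beta> \<gamma>" and conn: "connected (UNIV :: 'm set)"
  shows "reeb_coefficient \<alpha> \<beta> \<gamma> p = reeb_coefficient \<alpha> \<beta> \<gamma> q"
proof -
  interpret a: quasi_sasakian \<A> "\<phi> \<alpha>" "\<xi> \<alpha>" "\<eta> \<alpha>" g by (rule quasi_sasakian_perm(1)[OF perm])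
  interpret b: quasi_sasakian \<A> "\<phi> \<beta>" "\<xi> \<beta>" "\<eta> \<beta>" g by (rule quasi_sasakian_perm(2)[OF perm])
  interpret c: quasi_sasakian \<A> "\<phi> \<gamma>" "\<xi> \<gamma>" "\<eta> \<gamma>" g by (rule quasi_sasakian_perm(3)[OF perm])
  have "lie_bracket (\<xi> \<alpha>) (\<xi> \<beta>) = (\<lambda>p. reeb_coefficient \<alpha> \<beta> \<gamma> p *\<^sub>R \<xi> \<gamma> p)"
    by (rule ext) (rule lie_bracket_reeb[OF perm])
  then have "killing_field g (\<lambda>p. reeb_coefficient \<alpha> \<beta> \<gamma> p *\<^sub>R \<xi> \<gamma> p)"
    using killing_lie_bracket[OF metric a.killing b.killing] by simp
  then have "X p (reeb_coefficient \<alpha> \<beta> \<gamma>) = 0" if "vector_field \<A> X" for X p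
    using that
    by (intro killing_multiple_imp_derivative_zero[OF metric c.killing _ reeb_coefficient_smooth[OF perm]])
      (simp_all add: c.metric_reeb c.xi_tangent c.eta_xi)
  then show ?thesis
    by (rule constant_if_fields_vanish[OF conn reeb_coefficient_smooth[OF perm]])
qed

end

theorem theorem4p2:
  fixes \<A> :: "('m::{t2_space, second_countable_topology}, 'e::euclidean_space) chart set"
    and \<phi> :: "nat \<Rightarrow> 'm \<Rightarrow> 'm tvec \<Rightarrow> 'm tvec"
    and \<xi> :: "nat \<Rightarrow> 'm vfield"
    and \<eta> :: "nat \<Rightarrow> 'm \<Rightarrow> 'm tvec \<Rightarrow> real"
    and g :: "'m \<Rightarrow> 'm tvec \<Rightarrow> 'm tvec \<Rightarrow> real"
  assumes "connected (UNIV :: 'm set)"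
    and "three_quasi_sasakian \<A> \<phi> \<xi> \<eta> g"
  shows "\<exists>c::real. \<forall>\<alpha> \<beta> \<gamma>. even_perm3 \<alpha> \<beta> \<gamma> \<longrightarrow>
           lie_bracket (\<xi> \<alpha>) (\<xi> \<beta>) = c *\<^sub>R \<xi> \<gamma>"
proof -
  interpret three_quasi_sasakian \<A> \<phi> \<xi> \<eta> g by (rule assms(2))
  \<comment> \<open>\<open>undefined\<close> stands for an arbitrary point; by constancy its choice
    does not matter.\<close>
  define c where "c = reeb_coefficient 1 2 3 undefined"
  have perm: "even_perm3 1 2 3" "even_perm3 2 3 1" "even_perm3 3 1 2"
    by (simp_all add: even_perm3_iff)
  have coeff: "reeb_coefficient \<alpha> \<beta> \<gamma> p = c" if "even_perm3 \<alpha> \<beta> \<gamma>" for \<alpha> \<beta> \<gamma> p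
  proof -
    have "reeb_coefficient 1 2 3 p = c"
      unfolding c_def by (rule reeb_coefficient_constant[OF perm(1) assms(1)])
    moreover have "reeb_coefficient 3 1 2 p = reeb_coefficient 1 2 3 p"
      by (rule reeb_coefficient_cycle[OF perm(1)])
    moreover have "reeb_coefficient 2 3 1 p = reeb_coefficient 3 1 2 p"
      by (rule reeb_coefficient_cycle[OF perm(3)])
    ultimately show ?thesis
      using that by (auto simp: even_perm3_iff)
  qed
  have "lie_bracket (\<xi> \<alpha>) (\<xi> \<beta>) = c *\<^sub>R \<xi> \<gamma>" if "even_perm3 \<alpha> \<beta> \<gamma>" for \<alpha> \<beta> \<gamma>
  proof
    fix p
    show "lie_bracket (\<xi> \<alpha>) (\<xi> \<beta>) p = (c *\<^sub>R \<xi> \<gamma>) p"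
      using lie_bracket_reeb[OF that, of p] by (simp add: coeff[OF that] scaleR_fun_def)
  qed
  then show ?thesis by blast
qed

end
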